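(* Let $M$ be the manifold $LR^3$ with the ideal triangulation $\tau$ by four tetrahedra $A,B,C,D$ described in the context. Let $w_2$ be the root of $P(w)=w^4+2w^3-w^2-3w+2$ with numerical value $w_2\approx-1.7271548-0.6779619\,i$, and let "solution 2" of the compatibility and completeness equations for $\tau$ be the choice of moduli $$z_C=z_D=w_2,\qquad z_A=\frac{w_2^2}{1-w_2},\qquad z_B=\frac{w_2^2+w_2-1}{w_2^2}$$ (so $z_A\approx1.0724942+0.5921114\,i$, $z_B\approx0.2854042+0.3945194\,i$). Then solution 2 is not geometric.
   Context: **The manifold.** Let $L=\begin{pmatrix}1&1\\0&1\end{pmatrix}$, $R=\begin{pmatrix}1&0\\1&1\end{pmatrix}$. The manifold $LR^3$ is obtained from $S\times[0,1]$, $S=(\mathbb R^2\setminus\mathbb Z^2)/\mathbb Z^2$, by gluing $(x,0)$ to $(\varphi_{LR^3}(x),1)$, where $\varphi_{LR^3}$ is the homeomorphism of $S$ induced by $LR^3\in SL(2,\mathbb Z)$. It is one-cusped and has an ideal triangulation $\tau$ with four tetrahedra $A,B,C,D$ (obtained by the Floyd–Hatcher algorithm). Vertex labels: $A:\{0,\frac01,\frac11,\frac10\}$, $B:\{0,\frac11,\frac21,\frac10\}$, $C:\{0,\frac11,\frac32,\frac21\}$, $D:\{0,\frac11,\frac43,\frac32\}$. $X^v$ is the face of $X$ opposite to $v$. Face pairings: $A^{0/1}\leftrightarrow B^{2/1}:(0,\frac10,\frac11)\leftrightarrow(0,\frac10,\frac11)$; $A^{1/0}\leftrightarrow B^{0}:(0,\frac01,\frac11)\leftrightarrow(\frac10,\frac11,\frac21)$;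 $B^{1/0}\leftrightarrow C^{3/2}:(0,\frac11,\frac21)\leftrightarrow(0,\frac11,\frac21)$; $B^{1/1}\leftrightarrow C^{0}:(0,\frac10,\frac21)\leftrightarrow(\frac11,\frac21,\frac32)$; $C^{2/1}\leftrightarrow D^{4/3}:(0,\frac11,\frac32)\leftrightarrow(0,\frac11,\frac32)$; $C^{1/1}\leftrightarrow D^{0}:(0,\frac21,\frac32)\leftrightarrow(\frac11,\frac32,\frac43)$; $D^{3/2}\leftrightarrow A^{1/1}:(0,\frac11,\frac43)\leftrightarrow(0,\frac01,\frac10)$; $D^{1/1}\leftrightarrow A^{0}:(0,\frac32,\frac43)\leftrightarrow(\frac01,\frac10,\frac11)$. **Moduli.** A geodesic ideal tetrahedron (convex hull of four distinct points of $\partial\mathbb H^3=\mathbb C\cup\{\infty\}$, possibly flat) with ordered vertices $(v_1,v_2,v_3,v_4)$ has modulus $z$ (associated to the edge $v_1v_3$) if an element of $\mathrm{Isom}^+(\mathbb H^3)$ takes $(v_1,v_2,v_3,v_4)$ to $(0,1,\infty,z)$. The modulus at edges $v_1v_3,v_2v_4$ is $z$, at $v_2v_3,v_1v_4$ is $\frac1{1-z}$, at $v_1v_2,v_3v_4$ is $1-\frac1z$. Here all moduli are referred to the edge joining $0$ and $\frac11$, with orderings $A:(0,\frac01,\frac11,\frac10)$, $B:(0,\frac10,\frac11,\frac21)$, $C:(0,\frac21,\frac11,\frac32)$, $D:(0,\frac32,\frac11,\frac43)$, which also give the orientation. A choice of moduli assigns a number in $\mathbb C\setminus\{0,1\}$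 to each tetrahedron. The compatibility equations require that for each edge of $\tau$ the product of the moduli around it be $1$; the completeness equation requires that the holonomy of the boundary torus act by translations on $\mathbb C$ (when the cusp is placed at $\infty$). For $\tau$ they are together equivalent to $\frac{z_Dz_C(1-z_A)^2}{z_A}=-1$, $z_A=\frac1{1-z_B}$, $\left(\frac{z_D-1}{z_D}\right)^2\frac{z_A}{1-z_C}=1$, $\left(\frac{z_C-1}{z_C}\right)^2\frac{z_A}{1-z_D}=1$, and solution 2 satisfies them. **Geometric solution (completeness case).** For each tetrahedron $\Delta_i$ let $\Delta_i^*$ be $\Delta_i$ minus its vertices and $\varphi_{\Delta_i}:\Delta_i^*\to M$ the natural map given by the triangulation. A map $g:\Delta_i\to\overline{\mathbb H^3}$ is compatible with $z_i$ if it is continuous, its image is a geodesic ideal tetrahedron of modulus $z_i$ (with respect to the ordering above), and it is straight: vertices go to $\partial\mathbb H^3$, each sub-simplex $F$ is mapped into the convex hull of the image of its vertices, and $g|_F$ is a homeomorphism onto its image whenever $g|_{\partial F}$ is. A developing map for $(\tau,\mathbf z)$ is a continuous $D:\widetilde M\to\mathbb H^3$ on the universal cover such that for each $i$ the map $\varphi_{\Delta_i}$ has a lift $\widetilde\varphi_{\Delta_i}$ with $D\circ\widetilde\varphi_{\Delta_i}$ extending to a map $\Delta_i\to\overline{\mathbb H^3}$ compatible with $z_i$, and for any two lifts $\widetilde\varphi^1_{\Delta_i},\widetilde\varphi^2_{\Delta_i}$ there is $\Phi\in\mathrm{Isom}^+(\mathbb H^3)$ with $D\circ\widetilde\varphi^1_{\Delta_i}=\Phi\circ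 D\circ\widetilde\varphi^2_{\Delta_i}$. A map $f:M\to N$ to an oriented complete hyperbolic 3-manifold $N$ is hyperbolic w.r.t. $\mathbf z$ if its lift $\widetilde f:\widetilde M\to\mathbb H^3$ is a developing map. A solution $\mathbf z$ of the compatibility and completeness equations is geometric if $M$ is complete hyperbolic and there is a proper map $f:M\to M$ of degree 1, the target carrying its complete hyperbolic structure, which is hyperbolic w.r.t. $\mathbf z$. *)

theory Defs
  imports "HOL-Analysis.Analysis" "HOL-Homology.Homology"
begin

section \<open>The once-punctured torus bundle \<open>LR\<^sup>3\<close>\<close>

definition quotient_rel :: "'a topology \<Rightarrow> ('a \<Rightarrow> 'a \<Rightarrow> bool) \<Rightarrow> ('a \<times> 'a) set"
  where "quotient_rel X R =
    {(x, y). x \<in> topspace X \<and> y \<in> topspace X \<and>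
       equivclp (\<lambda>u v. u \<in> topspace X \<and> v \<in> topspace X \<and> R u v) x y}"

definition quotient_topology :: "'a topology \<Rightarrow> ('a \<Rightarrow> 'a \<Rightarrow> bool) \<Rightarrow> 'a set topology"
  where "quotient_topology X R =
    topology (\<lambda>V. V \<subseteq> topspace X // quotient_rel X R \<and> openin X (\<Union>V))"

lemma equiv_quotient_rel: "equiv (topspace X) (quotient_rel X R)"
proof (rule equivI)
  show "quotient_rel X R \<subseteq> topspace X \<times> topspace X"
    unfolding quotient_rel_def by blast
  show "refl_on (topspace X) (quotient_rel X R)"
    unfolding quotient_rel_def refl_on_def by simp
  show "sym (quotient_rel X R)"
    unfolding quotient_rel_def sym_def by (simp add: equivclp_sym)
  show "trans (quotient_rel X R)"
  proof (rule transI)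
    fix x y z
    assume "(x, y) \<in> quotient_rel X R" "(y, z) \<in> quotient_rel X R"
    then show "(x, z) \<in> quotient_rel X R"
      unfolding quotient_rel_def mem_Collect_eq prod.case
      by (elim conjE, intro conjI) (assumption | erule (1) equivclp_trans)+
  qed
qed

lemma openin_quotient_topology:
  "openin (quotient_topology X R) V \<longleftrightarrow>
     V \<subseteq> topspace X // quotient_rel X R \<and> openin X (\<Union>V)"
proof -
  have "istopology (\<lambda>V. V \<subseteq> topspace X // quotient_rel X R \<and> openin X (\<Union>V))"
    unfolding istopology_def
  proof (rule conjI; intro allI impI)
    fix S T
    assume S: "S \<subseteq> topspace X // quotient_rel X R \<and> openin X (\<Union>S)"
      and T: "T \<subseteq> topspace X // quotient_rel X R \<and> openin X (\<Union>T)"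
    have "\<Union>(S \<inter> T) = \<Union>S \<inter> \<Union>T"
    proof (rule subset_antisym)
      show "\<Union>S \<inter> \<Union>T \<subseteq> \<Union>(S \<inter> T)"
      proof
        fix x assume "x \<in> \<Union>S \<inter> \<Union>T"
        then obtain c d where cd: "c \<in> S" "x \<in> c" "d \<in> T" "x \<in> d" by blast
        then have "c = d"
          using S T quotient_disj[OF equiv_quotient_rel, of c X R d] by blast
        then show "x \<in> \<Union>(S \<inter> T)" using cd by blast
      qed
    qed blast
    then show "S \<inter> T \<subseteq> topspace X // quotient_rel X R \<and> openin X (\<Union>(S \<inter> T))"
      using S T by (simp add: openin_Int le_infI1)
  next
    fix K
    assume K: "\<forall>V\<in>K. V \<subseteq> topspace X // quotient_rel X R \<and> openin X (\<Union>V)"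
    have "\<Union>(\<Union>K) = \<Union>(Union ` K)"
      by blast
    moreover have "openin X (\<Union>(Union ` K))"
      using K by (intro openin_Union) blast
    ultimately show "\<Union>K \<subseteq> topspace X // quotient_rel X R \<and> openin X (\<Union>(\<Union>K))"
      using K by (simp add: Sup_le_iff)
  qed
  then show ?thesis
    by (simp add: quotient_topology_def topology_inverse')
qed

lemma topspace_quotient_topology:
  "topspace (quotient_topology X R) = topspace X // quotient_rel X R"
proof (rule subset_antisym)
  show "topspace (quotient_topology X R) \<subseteq> topspace X // quotient_rel X R"
    using openin_topspace[of "quotient_topology X R"]
    unfolding openin_quotient_topology by (rule conjunct1)
  have "openin (quotient_topology X R) (topspace X // quotient_rel X R)"
    unfolding openin_quotient_topology Union_quotient[OF equiv_quotient_rel] by simp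
  then show "topspace X // quotient_rel X R \<subseteq> topspace (quotient_topology X R)"
    by (rule openin_subset)
qed

lemma quotient_map_quotient_topology:
  "quotient_map X (quotient_topology X R) (\<lambda>x. quotient_rel X R `` {x})"
proof -
  have eq: "{x. x \<in> topspace X \<and> quotient_rel X R `` {x} \<in> U} = \<Union>U"
    if U: "U \<subseteq> topspace X // quotient_rel X R" for U
  proof (intro subset_antisym subsetI)
    fix x assume x: "x \<in> {x. x \<in> topspace X \<and> quotient_rel X R `` {x} \<in> U}"
    then have "x \<in> quotient_rel X R `` {x}"
      by (intro equiv_class_self[OF equiv_quotient_rel]) simp
    then show "x \<in> \<Union>U" using x by blast
  next
    fix x assume "x \<in> \<Union>U"
    then obtain c where c: "c \<in> U" "x \<in> c" by blast
    then obtain y where y: "c = quotient_rel X R `` {y}"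
      using U by (meson quotientE subsetD)
    then have yx: "(y, x) \<in> quotient_rel X R" using c by simp
    then have "x \<in> topspace X" by (simp add: quotient_rel_def)
    moreover have "quotient_rel X R `` {x} = c"
      unfolding y by (rule equiv_class_eq[OF equiv_quotient_rel yx, symmetric])
    ultimately show "x \<in> {x. x \<in> topspace X \<and> quotient_rel X R `` {x} \<in> U}"
      using c by simp
  qed
  have "(\<lambda>x. quotient_rel X R `` {x}) ` topspace X = topspace X // quotient_rel X R"
    by (simp add: quotient_def UNION_singleton_eq_range)
  then show ?thesis
    unfolding quotient_map_def topspace_quotient_topology openin_quotient_topology
    by (simp add: eq)
qed

definition int_lattice :: "(real^2) set"
  where "int_lattice = {x. \<forall>i. x $ i \<in> \<int>}"

definition punctured_torus :: "(real^2) set topology"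
  where "punctured_torus =
    quotient_topology (top_of_set (- int_lattice)) (\<lambda>x y. x - y \<in> int_lattice)"

definition mapping_torus :: "'a topology \<Rightarrow> ('a \<Rightarrow> 'a) \<Rightarrow> ('a \<times> real) set topology"
  where "mapping_torus S h =
    quotient_topology (prod_topology S (top_of_set {0..1}))
      (\<lambda>a b. \<exists>x. a = (x, 0) \<and> b = (h x, 1))"

definition matL :: "real^2^2" where "matL = vector [vector [1, 1], vector [0, 1]]"

definition matR :: "real^2^2" where "matR = vector [vector [1, 0], vector [1, 1]]"

text \<open>Points of the punctured torus are cosets of the integer lattice, so a matrix in
  \<open>SL(2, \<int>)\<close> acts on them by taking images.\<close>

definition LR3 :: "((real^2) set \<times> real) set topology"
  where "LR3 = mapping_torus punctured_torus (image ((*v) (matL ** matR ** matR ** matR)))"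


section \<open>The ideal triangulation\<close>

text \<open>The label \<open>V0\<close> stands for the vertex \<open>0\<close>, and \<open>Vmn\<close> for the vertex \<open>m/n\<close>.\<close>

datatype vlabel = V0 | V01 | V11 | V10 | V21 | V32 | V43

instance vlabel :: finite
proof
  have "(UNIV :: vlabel set) = {V0, V01, V11, V10, V21, V32, V43}"
    using vlabel.exhaust by auto
  then show "finite (UNIV :: vlabel set)"
    by (metis finite.emptyI finite.insertI)
qed

datatype tet = TA | TB | TC | TD

text \<open>The ordered vertices \<open>(v\<^sub>1, v\<^sub>2, v\<^sub>3, v\<^sub>4)\<close> of each tetrahedron; the modulus refers
  to the edge \<open>v\<^sub>1v\<^sub>3\<close>.\<close>

fun verts :: "tet \<Rightarrow> vlabel list" where
  "verts TA = [V0, V01, V11, V10]"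
| "verts TB = [V0, V10, V11, V21]"
| "verts TC = [V0, V21, V11, V32]"
| "verts TD = [V0, V32, V11, V43]"

definition face_pairings :: "((tet \<times> vlabel list) \<times> (tet \<times> vlabel list)) set"
  where "face_pairings =
   {((TA, [V0, V10, V11]), (TB, [V0, V10, V11])),
    ((TA, [V0, V01, V11]), (TB, [V10, V11, V21])),
    ((TB, [V0, V11, V21]), (TC, [V0, V11, V21])),
    ((TB, [V0, V10, V21]), (TC, [V11, V21, V32])),
    ((TC, [V0, V11, V32]), (TD, [V0, V11, V32])),
    ((TC, [V0, V21, V32]), (TD, [V11, V32, V43])),
    ((TD, [V0, V11, V43]), (TA, [V0, V01, V10])),
    ((TD, [V0, V32, V43]), (TA, [V01, V10, V11]))}"

definition subsimplex :: "vlabel set \<Rightarrow> (real^vlabel) set"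
  where "subsimplex F = convex hull ((\<lambda>a. axis a 1) ` F)"

definition tetra :: "tet \<Rightarrow> (real^vlabel) set"
  where "tetra X = subsimplex (set (verts X))"

definition ideal_tetra :: "tet \<Rightarrow> (real^vlabel) set"
  where "ideal_tetra X = tetra X - (\<lambda>a. axis a 1) ` set (verts X)"

text \<open>Coordinates of \<open>real^vlabel\<close> are barycentric coordinates: a face pairing identifies
  two points lying on the paired faces and having equal coordinates at corresponding vertices.\<close>

definition glued :: "tet \<times> (real^vlabel) \<Rightarrow> tet \<times> (real^vlabel) \<Rightarrow> bool"
  where "glued a b \<longleftrightarrow>
    (\<exists>F G. ((fst a, F), (fst b, G)) \<in> face_pairings \<and>
       snd a \<in> ideal_tetra (fst a) \<inter> subsimplex (set F) \<and>
       snd b \<in> ideal_tetra (fst b) \<inter> subsimplex (set G) \<and>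
       map (($) (snd a)) F = map (($) (snd b)) G)"

text \<open>\<open>\<phi> X\<close> is the natural map from the tetrahedron \<open>X\<close> minus its vertices to \<open>M\<close>. The
  conditions say that the \<open>\<phi> X\<close> together induce a homeomorphism from the glued complex onto
  \<open>M\<close>.\<close>

definition ideal_triangulation ::
    "'m::topological_space set \<Rightarrow> (tet \<Rightarrow> real^vlabel \<Rightarrow> 'm) \<Rightarrow> bool"
  where "ideal_triangulation M \<phi> \<longleftrightarrow>
    quotient_map (sum_topology (\<lambda>X. top_of_set (ideal_tetra X)) UNIV) (top_of_set M)
      (\<lambda>a. \<phi> (fst a) (snd a)) \<and>
    (\<forall>X Y. \<forall>s\<in>ideal_tetra X. \<forall>t\<in>ideal_tetra Y.
       \<phi> X s = \<phi> Y t \<longleftrightarrow> equivclp glued (X, s) (Y, t))"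


section \<open>Hyperbolic space\<close>

text \<open>We use the projective (Klein) ball model: hyperbolic space is the open unit ball of
  \<open>real^3\<close>, its compactification is the closed ball, and hyperbolic convex hulls, also of
  ideal points, are Euclidean convex hulls. The unit sphere is identified with
  \<open>\<complex> \<union> {\<infinity>}\<close> by stereographic projection from the north pole, which makes the standard
  orientation of the ball agree with that of the upper half-space over \<open>\<complex>\<close>.\<close>

abbreviation H3 :: "(real^3) set" where "H3 \<equiv> ball 0 1"

definition hdist :: "real^3 \<Rightarrow> real^3 \<Rightarrow> real"
  where "hdist x y = arcosh ((1 - x \<bullet> y) / (sqrt (1 - x \<bullet> x) * sqrt (1 - y \<bullet> y)))"

definition bd_point :: "complex \<Rightarrow> real^3"
  where "bd_point z = (1 / ((cmod z)\<^sup>2 + 1)) *\<^sub>R vector [2 * Re z, 2 * Im z, (cmod z)\<^sup>2 - 1]"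

definition bd_infinity :: "real^3"
  where "bd_infinity = vector [0, 0, 1]"

text \<open>Orientation-preserving isometries, together with their continuous extension to the
  sphere at infinity. Values outside the closed ball are irrelevant.\<close>

definition Isom_plus :: "(real^3 \<Rightarrow> real^3) set"
  where "Isom_plus =
    {\<Phi>. continuous_on (cball 0 1) \<Phi> \<and> bij_betw \<Phi> H3 H3 \<and>
        (\<forall>x\<in>H3. \<forall>y\<in>H3. hdist (\<Phi> x) (\<Phi> y) = hdist x y) \<and>
        (\<forall>x\<in>H3. \<exists>\<Phi>'. (\<Phi> has_derivative \<Phi>') (at x) \<and> 0 < det (matrix \<Phi>'))}"

definition has_modulus :: "real^3 \<Rightarrow> real^3 \<Rightarrow> real^3 \<Rightarrow> real^3 \<Rightarrow> complex \<Rightarrow> bool"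
  where "has_modulus v1 v2 v3 v4 z \<longleftrightarrow>
    {v1, v2, v3, v4} \<subseteq> sphere 0 1 \<and> card {v1, v2, v3, v4} = 4 \<and>
    (\<exists>\<Phi>\<in>Isom_plus. \<Phi> v1 = bd_point 0 \<and> \<Phi> v2 = bd_point 1 \<and>
                    \<Phi> v3 = bd_infinity \<and> \<Phi> v4 = bd_point z)"


section \<open>Developing maps and hyperbolic maps\<close>

definition homeo_onto_image :: "'a::topological_space set \<Rightarrow> ('a \<Rightarrow> 'b::topological_space) \<Rightarrow> bool"
  where "homeo_onto_image S g \<longleftrightarrow> (\<exists>h. homeomorphism S (g ` S) g h)"

text \<open>The relative frontier of a simplex is its combinatorial boundary; that of a vertex is
  empty. For \<open>F = set (verts X)\<close> the third condition says that vertices of \<open>X\<close> go to four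
  distinct ideal points; together with the fourth, the image is a geodesic ideal tetrahedron.\<close>

definition compatible_map :: "tet \<Rightarrow> complex \<Rightarrow> (real^vlabel \<Rightarrow> real^3) \<Rightarrow> bool"
  where "compatible_map X z g \<longleftrightarrow>
    (let v = (\<lambda>a. g (axis a 1)) in
      continuous_on (tetra X) g \<and>
      has_modulus (v (verts X ! 0)) (v (verts X ! 1)) (v (verts X ! 2)) (v (verts X ! 3)) z \<and>
      g ` tetra X = convex hull (v ` set (verts X)) \<and>
      (\<forall>F \<subseteq> set (verts X). g ` subsimplex F \<subseteq> convex hull (v ` F)) \<and>
      (\<forall>F \<subseteq> set (verts X). homeo_onto_image (rel_frontier (subsimplex F)) g \<longrightarrow>
                              homeo_onto_image (subsimplex F) g))"

definition is_lift :: "'u::topological_space set \<Rightarrow> ('u \<Rightarrow> 'm) \<Rightarrow> 'a::topological_space set \<Rightarrow>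
    ('a \<Rightarrow> 'm) \<Rightarrow> ('a \<Rightarrow> 'u) \<Rightarrow> bool"
  where "is_lift U p S f \<psi> \<longleftrightarrow>
    continuous_on S \<psi> \<and> \<psi> \<in> S \<rightarrow> U \<and> (\<forall>s\<in>S. p (\<psi> s) = f s)"

definition universal_cover ::
    "'u::real_normed_vector set \<Rightarrow> ('u \<Rightarrow> 'm::topological_space) \<Rightarrow> 'm set \<Rightarrow> bool"
  where "universal_cover U p M \<longleftrightarrow> simply_connected U \<and> covering_space U p M"

definition developing_map :: "(tet \<Rightarrow> real^vlabel \<Rightarrow> 'm) \<Rightarrow> 'u::topological_space set \<Rightarrow>
    ('u \<Rightarrow> 'm) \<Rightarrow> (tet \<Rightarrow> complex) \<Rightarrow> ('u \<Rightarrow> real^3) \<Rightarrow> bool"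
  where "developing_map \<phi> U p z dev \<longleftrightarrow>
    continuous_on U dev \<and> dev \<in> U \<rightarrow> H3 \<and>
    (\<forall>X.
      (\<exists>\<psi>. is_lift U p (ideal_tetra X) (\<phi> X) \<psi> \<and>
           (\<exists>g. compatible_map X (z X) g \<and> (\<forall>s\<in>ideal_tetra X. g s = dev (\<psi> s)))) \<and>
      (\<forall>\<psi>1 \<psi>2. is_lift U p (ideal_tetra X) (\<phi> X) \<psi>1 \<and> is_lift U p (ideal_tetra X) (\<phi> X) \<psi>2 \<longrightarrow>
           (\<exists>\<Phi>\<in>Isom_plus. \<forall>s\<in>ideal_tetra X. dev (\<psi>1 s) = \<Phi> (dev (\<psi>2 s)))))"

text \<open>A complete hyperbolic structure on an orientable \<open>N\<close> is given by its universal covering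
  \<open>q\<close> from \<open>H3\<close>, which exhibits \<open>N\<close> as the quotient of \<open>H3\<close> by a group of
  orientation-preserving isometries acting by deck transformations.\<close>

definition complete_hyperbolic_structure ::
    "'n::topological_space set \<Rightarrow> (real^3 \<Rightarrow> 'n) \<Rightarrow> bool"
  where "complete_hyperbolic_structure N q \<longleftrightarrow>
    covering_space H3 q N \<and>
    (\<forall>x\<in>H3. \<forall>y\<in>H3. q x = q y \<longrightarrow>
       (\<exists>\<Phi>\<in>Isom_plus. \<Phi> x = y \<and> (\<forall>w\<in>H3. q (\<Phi> w) = q w)))"

text \<open>\<open>f\<close> maps the triangulated manifold with universal cover \<open>(U, p)\<close> to the complete
  hyperbolic manifold with universal covering \<open>q\<close>.\<close>

definition hyperbolic_map :: "(tet \<Rightarrow> real^vlabel \<Rightarrow> 'm) \<Rightarrow> 'u::topological_space set \<Rightarrow>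
    ('u \<Rightarrow> 'm) \<Rightarrow> (tet \<Rightarrow> complex) \<Rightarrow> (real^3 \<Rightarrow> 'n) \<Rightarrow> ('m \<Rightarrow> 'n) \<Rightarrow> bool"
  where "hyperbolic_map \<phi> U p z q f \<longleftrightarrow>
    (\<exists>dev. is_lift H3 q U (f \<circ> p) dev \<and> developing_map \<phi> U p z dev)"


section \<open>Orientation and degree\<close>

text \<open>For a map \<open>h\<close> that is a topological embedding near \<open>x\<close>, orientation is detected on local
  homology: \<open>h\<close>, translated so that \<open>h x\<close> goes to \<open>0\<close>, and the translation of \<open>x\<close> to \<open>0\<close>
  induce the same map from \<open>H\<^sub>3(W, W - {x})\<close> to \<open>H\<^sub>3(\<real>\<^sup>3, \<real>\<^sup>3 - {0})\<close>. By excision the choice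
  of \<open>W\<close> does not matter.\<close>

definition orientation_preserving_at :: "(real^3 \<Rightarrow> real^3) \<Rightarrow> real^3 \<Rightarrow> bool"
  where "orientation_preserving_at h x \<longleftrightarrow>
    (\<exists>W. open W \<and> x \<in> W \<and> continuous_on W h \<and> inj_on h W \<and>
      (\<forall>c \<in> carrier (relative_homology_group 3 (top_of_set W) (W - {x})).
        hom_induced 3 (top_of_set W) (W - {x}) euclidean (- {0}) (\<lambda>y. h y - h x) c =
        hom_induced 3 (top_of_set W) (W - {x}) euclidean (- {0}) (\<lambda>y. y - x) c))"

text \<open>The ordering of the vertices orients \<open>X\<close> so that straight maps to ideal tetrahedra of
  modulus with positive imaginary part preserve orientation; \<open>orient_chart X\<close> is the affine map
  to the ideal tetrahedron of modulus \<open>\<i>\<close>.\<close>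

definition orient_chart :: "tet \<Rightarrow> real^vlabel \<Rightarrow> real^3"
  where "orient_chart X s =
    (s $ (verts X ! 0)) *\<^sub>R bd_point 0 + (s $ (verts X ! 1)) *\<^sub>R bd_point 1 +
    (s $ (verts X ! 2)) *\<^sub>R bd_infinity + (s $ (verts X ! 3)) *\<^sub>R bd_point \<i>"

definition orientation_preserving_cover ::
    "(tet \<Rightarrow> real^vlabel \<Rightarrow> 'm) \<Rightarrow> (real^3 \<Rightarrow> 'm) \<Rightarrow> bool"
  where "orientation_preserving_cover \<phi> q \<longleftrightarrow>
    (\<forall>X. \<forall>x\<in>H3. q x \<in> \<phi> X ` rel_interior (tetra X) \<longrightarrow>
       orientation_preserving_at
         (\<lambda>y. orient_chart X (inv_into (rel_interior (tetra X)) (\<phi> X) (q y))) x)"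

text \<open>The degree of a proper self-map of a connected oriented \<open>n\<close>-manifold \<open>X\<close> is the integer by
  which its extension acts on \<open>H\<^sub>n\<close> of the one-point compactification, that is, on the infinite
  cyclic group \<open>H\<^sub>n(X \<union> {\<infinity>}, \<infinity>)\<close> generated by the fundamental class. Compare
  \<^const>\<open>Brouwer_degree2\<close>.\<close>

definition proper_degree :: "nat \<Rightarrow> 'a topology \<Rightarrow> ('a \<Rightarrow> 'a) \<Rightarrow> int"
  where "proper_degree n X f =
    (SOME d::int. \<forall>c \<in> carrier (homology_group (int n) (Alexandroff_compactification X)).
       hom_induced (int n) (Alexandroff_compactification X) {}
                           (Alexandroff_compactification X) {} (map_option f) c =
       pow (homology_group (int n) (Alexandroff_compactification X)) c d)"


section \<open>Geometric solutions\<close>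

text \<open>The compatibility equations (products of moduli around edges are \<open>1\<close>) and the completeness
  equation, in the reduced form that they take for this triangulation.\<close>

definition hyperbolicity_equations :: "(tet \<Rightarrow> complex) \<Rightarrow> bool"
  where "hyperbolicity_equations z \<longleftrightarrow>
    (\<forall>X. z X \<noteq> 0 \<and> z X \<noteq> 1) \<and>
    z TD * z TC * (1 - z TA)\<^sup>2 / z TA = -1 \<and>
    z TA = 1 / (1 - z TB) \<and>
    ((z TD - 1) / z TD)\<^sup>2 * (z TA / (1 - z TC)) = 1 \<and>
    ((z TC - 1) / z TC)\<^sup>2 * (z TA / (1 - z TD)) = 1"

text \<open>Here \<open>(U, p)\<close> is the universal cover of \<open>M\<close>; the notion does not depend on its choice. It is
  meant for solutions \<open>z\<close> of the hyperbolicity equations.\<close>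

definition geometric :: "'m::topological_space set \<Rightarrow> (tet \<Rightarrow> real^vlabel \<Rightarrow> 'm) \<Rightarrow>
    'u::topological_space set \<Rightarrow> ('u \<Rightarrow> 'm) \<Rightarrow> (tet \<Rightarrow> complex) \<Rightarrow> bool"
  where "geometric M \<phi> U p z \<longleftrightarrow>
    (\<exists>q f. complete_hyperbolic_structure M q \<and> orientation_preserving_cover \<phi> q \<and>
       continuous_on M f \<and> f \<in> M \<rightarrow> M \<and>
       proper_map (top_of_set M) (top_of_set M) f \<and>
       proper_degree 3 (top_of_set M) f = 1 \<and>
       hyperbolic_map \<phi> U p z q f)"

definition P_poly :: "complex \<Rightarrow> complex"
  where "P_poly w = w^4 + 2 * w^3 - w\<^sup>2 - 3 * w + 2"

fun solution :: "complex \<Rightarrow> tet \<Rightarrow> complex" where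
  "solution w TA = w\<^sup>2 / (1 - w)"
| "solution w TB = (w\<^sup>2 + w - 1) / w\<^sup>2"
| "solution w TC = w"
| "solution w TD = w"

lemma hyperbolicity_equations_solution:
  assumes "P_poly w = 0"
  shows "hyperbolicity_equations (solution w)"
proof -
  have P: "w^4 + 2 * w^3 - w\<^sup>2 - 3 * w + 2 = 0"
    using assms by (simp add: P_poly_def)
  have w0: "w \<noteq> 0" and w1: "w \<noteq> 1"
    using P by auto
  have wa: "w\<^sup>2 + w - 1 \<noteq> 0"
  proof
    assume h: "w\<^sup>2 + w - 1 = 0"
    have "w^4 + 2 * w^3 - w\<^sup>2 - 3 * w + 2 = (w\<^sup>2 + w - 1) * (w\<^sup>2 + w - 1) - w + 1"
      by (simp add: algebra_simps power2_eq_square power3_eq_cube power4_eq_xxxx)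
    then show False using h P w1 by simp
  qed
  have e: "w^4 + 2 * w^3 - w\<^sup>2 - 3 * w + 2 = (w\<^sup>2 + w - 1)\<^sup>2 - w + 1"
    by (simp add: algebra_simps power2_eq_square power3_eq_cube power4_eq_xxxx)
  then have "(w\<^sup>2 + w - 1)\<^sup>2 - w + 1 = 0"
    using P by simp
  moreover have "(w\<^sup>2 + w - 1)\<^sup>2 = ((w\<^sup>2 + w - 1)\<^sup>2 - w + 1) + (w - 1)"
    by simp
  ultimately have sq: "(w\<^sup>2 + w - 1)\<^sup>2 = w - 1"
    by simp
  have "w\<^sup>2 \<noteq> 1 - w" using wa by auto
  have X1: "1 - w \<noteq> 0" using w1 by auto
  have A1: "1 - w\<^sup>2 / (1 - w) = - (w\<^sup>2 + w - 1) / (1 - w)"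
    using X1 by (simp add: field_simps)
  have "(1 - w\<^sup>2 / (1 - w))\<^sup>2 = (w - 1) / (1 - w)\<^sup>2"
    unfolding A1 by (simp only: power_divide power2_minus sq)
  then have A2: "(1 - w\<^sup>2 / (1 - w))\<^sup>2 = - 1 / (1 - w)"
    using X1 by (simp add: divide_simps power2_eq_square)
  have B1: "1 - (w\<^sup>2 + w - 1) / w\<^sup>2 = (1 - w) / w\<^sup>2"
    using w0 by (simp add: field_simps)
  have eq1: "w * w * (1 - w\<^sup>2 / (1 - w))\<^sup>2 / (w\<^sup>2 / (1 - w)) = -1"
    unfolding A2 using w0 X1 by (simp add: field_simps power2_eq_square)
  have "((w - 1) / w)\<^sup>2 = (1 - w)\<^sup>2 / w\<^sup>2"
    by (simp add: power_divide power2_commute)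
  moreover have "(w\<^sup>2 / (1 - w)) / (1 - w) = w\<^sup>2 / (1 - w)\<^sup>2"
    by (simp add: power2_eq_square)
  ultimately have eq3: "((w - 1) / w)\<^sup>2 * ((w\<^sup>2 / (1 - w)) / (1 - w)) = 1"
    using w0 X1 by simp
  have nz: "solution w X \<noteq> 0 \<and> solution w X \<noteq> 1" for X
    using w0 w1 X1 wa \<open>w\<^sup>2 \<noteq> 1 - w\<close> by (cases X) auto
  show ?thesis
    unfolding hyperbolicity_equations_def using nz eq1 eq3 B1 by auto
qed

end

(*
If solution 2 were geometric, the developing map would carry every lift of a tetrahedron to a
straight ideal tetrahedron of the prescribed modulus, and any two lifts of the same tetrahedron
would differ by an element of the deck group of the covering of M by hyperbolic space, which is
discrete. Developing from D across four faces and back to D, in two ways, yields two parabolic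
elements of this group: the translation by t and a matrix of determinant 1 with lower left entry
c, where c t v^3 = v - 1 for v = w2^2 + w2 - 1. Here 0 < |c t| < 1, which contradicts Shimizu's
lemma.

Orientation-preserving isometries act on the sphere at infinity as Moebius maps: in the Klein
model the isometry condition passes to the boundary and gives the absolute values of cross
ratios, and the sign of the Jacobian determinant gives the sign of their imaginary parts.
*)

theory Submission
  imports Defs
begin

section \<open>Ideal points in homogeneous coordinates\<close>

text \<open>The moduli of \<open>C\<close> and \<open>D\<close> have negative imaginary part, but
  this alone is no contradiction: a compatible map may reverse the orientation of a tetrahedron, so
  \<open>f\<close> may fold. The obstruction is sought in the holonomy instead. The two loops turn
  around the ideal vertices 1/1 and 3/2 of \<open>D\<close>, so completeness makes their holonomies
  parabolic; in the frame of \<open>D\<close> the fixed points are infinity and 1. They differ,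
  which is the setting of Shimizu's lemma.

  A hyperbolic map controls the interior of a tetrahedron only loosely, so all bookkeeping is done
  at ideal vertices. A developed copy is recorded by a matrix, up to scale, that carries (0, 1,
  infinity, z) to its vertices. Three common vertices determine the matrix behind a face, and
  discreteness becomes a statement on convergent sequences of matrices. The price is that
  \<open>Isom_plus\<close>, given by metric conditions inside the ball, must be shown to act on the
  sphere by matrices.\<close>

definition cross2 :: "complex^2 \<Rightarrow> complex^2 \<Rightarrow> complex"
  where "cross2 u v = u $ 1 * v $ 2 - u $ 2 * v $ 1"

text \<open>The Hopf map: inverse stereographic projection of \<open>v $ 1 / v $ 2\<close>, written
  homogeneously so that infinity needs no separate case and Moebius maps become linear.\<close>

definition ideal_point :: "complex^2 \<Rightarrow> real^3"
  where "ideal_point v = (1 / (norm v)\<^sup>2) *\<^sub>R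
    vector [2 * Re (v $ 1 * cnj (v $ 2)), 2 * Im (v $ 1 * cnj (v $ 2)), (cmod (v $ 1))\<^sup>2 -
        (cmod (v $ 2))\<^sup>2]"

lemma norm_power2_complex2: "(norm (v::complex^2))\<^sup>2 = (cmod (v $ 1))\<^sup>2 + (cmod (v $ 2))\<^sup>2"
  by (simp add: norm_vec_def L2_set_def sum_2)

lemma inner_vec3: "(x::real^3) \<bullet> y = x $ 1 * y $ 1 + x $ 2 * y $ 2 + x $ 3 * y $ 3"
  by (simp add: inner_vec_def sum_3)

text \<open>\<open>1 - x \<bullet> y\<close> is the Lorentz product of \<open>(1, x)\<close> and
  \<open>(1, y)\<close>. On light-like vectors coming from \<open>complex^2\<close> it is the
  squared modulus of the area form, so conditions on the sphere become conditions on
  \<open>cross2\<close>.\<close>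

lemma one_minus_inner_ideal_point:
  assumes "u \<noteq> 0" "v \<noteq> 0"
  shows "1 - ideal_point u \<bullet> ideal_point v = 2 * (cmod (cross2 u v))\<^sup>2 / ((norm u)\<^sup>2 * (norm v)\<^sup>2)"
proof -
  define p q where "p = (norm u)\<^sup>2" and "q = (norm v)\<^sup>2"
  define X where "X = 4 * Re (u $ 1 * cnj (u $ 2)) * Re (v $ 1 * cnj (v $ 2))
      + 4 * Im (u $ 1 * cnj (u $ 2)) * Im (v $ 1 * cnj (v $ 2))
      + ((cmod (u $ 1))\<^sup>2 - (cmod (u $ 2))\<^sup>2) * ((cmod (v $ 1))\<^sup>2 - (cmod (v $ 2))\<^sup>2)"
  have pq: "p \<noteq> 0" "q \<noteq> 0" using assms by (auto simp: p_def q_def)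
  have "ideal_point u \<bullet> ideal_point v = X / (p * q)"
    by (simp add: ideal_point_def inner_vec3 X_def p_def q_def add_divide_distrib
        diff_divide_distrib algebra_simps)
  moreover have "p * q - X = 2 * (cmod (cross2 u v))\<^sup>2"
    unfolding p_def q_def norm_power2_complex2 X_def cross2_def cmod_power2
    by (simp add: algebra_simps power2_eq_square)
  ultimately have "1 - ideal_point u \<bullet> ideal_point v = 2 * (cmod (cross2 u v))\<^sup>2 / (p * q)"
    using pq by (metis diff_divide_distrib divide_self mult_eq_0_iff)
  then show ?thesis by (simp add: p_def q_def)
qed

lemma cross2_self [simp]: "cross2 u u = 0"
  by (simp add: cross2_def)

lemma norm_ideal_point: "v \<noteq> 0 \<Longrightarrow> norm (ideal_point v) = 1"
  using one_minus_inner_ideal_point[of v v] by (simp add: norm_eq_1)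

lemma ideal_point_eq_iff:
  assumes "u \<noteq> 0" "v \<noteq> 0"
  shows "ideal_point u = ideal_point v \<longleftrightarrow> cross2 u v = 0"
proof
  assume "ideal_point u = ideal_point v"
  then show "cross2 u v = 0"
    using one_minus_inner_ideal_point[OF assms] one_minus_inner_ideal_point[OF assms(1)
        assms(1)] assms by simp
next
  assume "cross2 u v = 0"
  then have "ideal_point u \<bullet> ideal_point v = 1"
    using one_minus_inner_ideal_point[OF assms] by simp
  then have "(norm (ideal_point u - ideal_point v))\<^sup>2 = 0"
    using norm_ideal_point[OF assms(1)] norm_ideal_point[OF assms(2)]
    by (simp add: dot_norm_neg)
  then show "ideal_point u = ideal_point v" by simp
qed

lemma vec3_eq_iff: "(x::real^3) = y \<longleftrightarrow> x $ 1 = y $ 1 \<and> x $ 2 = y $ 2 \<and> x $ 3 = y $ 3"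
  by (simp add: vec_eq_iff forall_3)

lemma vec2_eq_iff: "(x::'a^2) = y \<longleftrightarrow> x $ 1 = y $ 1 \<and> x $ 2 = y $ 2"
  by (simp add: vec_eq_iff forall_2)

lemma ideal_point_surj:
  assumes "norm x = 1"
  obtains v where "v \<noteq> 0" "ideal_point v = x"
proof (cases "x $ 3 = 1")
  have x: "(x $ 1)\<^sup>2 + (x $ 2)\<^sup>2 + (x $ 3)\<^sup>2 = 1"
    using assms by (simp add: norm_eq_1 inner_vec3 power2_eq_square)
  {
    case True
    then have "x $ 1 = 0" "x $ 2 = 0"
      using x by (auto simp: sum_power2_eq_zero_iff)
    with True show ?thesis
      by (intro that[of "vector [1, 0]"])
         (auto simp: ideal_point_def norm_power2_complex2 vec3_eq_iff vec2_eq_iff)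
  next
    case False
    \<comment> \<open>Stereographic projection from the north pole, kept as numerator and
      denominator.\<close>
    define v :: "complex^2" where "v =
        vector [Complex (x $ 1) (x $ 2), complex_of_real (1 - x $ 3)]"
    have v: "v \<noteq> 0" using False by (auto simp: v_def vec2_eq_iff)
    have n: "(norm v)\<^sup>2 = 2 * (1 - x $ 3)"
      unfolding norm_power2_complex2 cmod_power2 using x
      by (simp add: v_def power2_eq_square algebra_simps)
    have "ideal_point v = x"
      unfolding ideal_point_def n cmod_power2 using False x
      by (simp add: vec3_eq_iff v_def field_simps power2_eq_square)
    with v show ?thesis by (rule that)
  }
qed

lemma bd_point_eq_ideal_point: "bd_point z = ideal_point (vector [z, 1])"
  by (simp add: bd_point_def ideal_point_def norm_power2_complex2 vec3_eq_iff)

lemma bd_infinity_eq_ideal_point: "bd_infinity = ideal_point (vector [1, 0])"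
  by (simp add: bd_infinity_def ideal_point_def norm_power2_complex2 vec3_eq_iff)

section \<open>Isometries at infinity\<close>

text \<open>The reversed Cauchy-Schwarz inequality of the Lorentz form. It keeps the argument in the
  range where \<open>cosh\<close> undoes \<open>arcosh\<close>, so that equal distances give equal
  arguments.\<close>

lemma hdist_arg_ge_1:
  assumes "x \<in> H3" "y \<in> H3"
  shows "(1 - x \<bullet> y) / (sqrt (1 - x \<bullet> x) * sqrt (1 - y \<bullet> y)) \<ge> 1"
proof -
  have n: "norm x < 1" "norm y < 1" using assms by auto
  have p: "0 < 1 - x \<bullet> x" "0 < 1 - y \<bullet> y"
    using n by (simp_all add: dot_square_norm abs_square_less_1)
  have xy: "norm x * norm y < 1"
    using n by (smt (verit) mult_left_le norm_ge_zero)
  have "sqrt (1 - x \<bullet> x) * sqrt (1 - y \<bullet> y) = sqrt ((1 - (norm x)\<^sup>2) * (1 - (norm y)\<^sup>2))"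
    by (simp add: real_sqrt_mult dot_square_norm)
  also have "\<dots> \<le> 1 - norm x * norm y"
  proof (rule real_le_lsqrt)
    have "0 \<le> (norm x - norm y)\<^sup>2" by simp
    then show "(1 - (norm x)\<^sup>2) * (1 - (norm y)\<^sup>2) \<le> (1 - norm x * norm y)\<^sup>2"
      by (simp add: power2_eq_square algebra_simps)
  qed (use xy in simp)
  also have "\<dots> \<le> 1 - x \<bullet> y"
    using norm_cauchy_schwarz[of x y] by simp
  finally show ?thesis using p by (simp add: le_divide_eq)
qed

lemma hdist_eq_iff:
  assumes "x \<in> H3" "y \<in> H3" "x' \<in> H3" "y' \<in> H3" "hdist x' y' = hdist x y"
  shows "(1 - x' \<bullet> y') / (sqrt (1 - x' \<bullet> x') * sqrt (1 - y' \<bullet> y')) =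
         (1 - x \<bullet> y) / (sqrt (1 - x \<bullet> x) * sqrt (1 - y \<bullet> y))"
  using arg_cong[OF assms(5), of cosh] hdist_arg_ge_1[OF assms(1,2)] hdist_arg_ge_1[OF assms(3,4)]
  unfolding hdist_def by (simp add: cosh_arcosh_real)

text \<open>\<open>(1, x) / klein_scale x\<close> is the point of the hyperboloid model, so the
  quotient preserved by isometries is a Lorentz product of unit vectors.\<close>

definition klein_scale :: "real^3 \<Rightarrow> real" where "klein_scale x = sqrt (1 - x \<bullet> x)"

lemma klein_scale_pos: "x \<in> H3 \<Longrightarrow> 0 < klein_scale x"
  by (simp add: klein_scale_def dot_square_norm abs_square_less_1)

lemma one_minus_inner_pos:
  fixes x u :: "real^3"
  assumes "x \<in> H3" "norm u \<le> 1" shows "0 < 1 - x \<bullet> u"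
proof -
  have "x \<bullet> u \<le> norm x * norm u" by (rule norm_cauchy_schwarz)
  also have "\<dots> \<le> norm x * 1" by (rule mult_left_mono) (use assms in auto)
  finally show ?thesis using assms by simp
qed

lemma Isom_plusD:
  assumes "\<Phi> \<in> Isom_plus"
  shows "continuous_on (cball 0 1) \<Phi>" "\<And>x. x \<in> H3 \<Longrightarrow> \<Phi> x \<in> H3"
    "\<And>x y. x \<in> H3 \<Longrightarrow> y \<in> H3 \<Longrightarrow>
      (1 - \<Phi> x \<bullet> \<Phi> y) / (klein_scale (\<Phi> x) * klein_scale (\<Phi> y)) =
          (1 - x \<bullet> y) / (klein_scale x * klein_scale y)"
    "\<And>x. x \<in> H3 \<Longrightarrow> \<exists>\<Phi>'. (\<Phi> has_derivative \<Phi>') (at x) \<and> 0 < det (matrix \<Phi>')"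
proof -
  show c: "continuous_on (cball 0 1) \<Phi>" "\<And>x. x \<in> H3 \<Longrightarrow> \<Phi> x \<in> H3"
    "\<And>x. x \<in> H3 \<Longrightarrow> \<exists>\<Phi>'. (\<Phi> has_derivative \<Phi>') (at x) \<and> 0 < det (matrix \<Phi>')"
    using assms unfolding Isom_plus_def by (auto dest!: bij_betw_imp_surj_on)
  fix x y :: "real^3" assume xy: "x \<in> H3" "y \<in> H3"
  moreover have "hdist (\<Phi> x) (\<Phi> y) = hdist x y"
    using assms xy unfolding Isom_plus_def by auto
  ultimately show "(1 - \<Phi> x \<bullet> \<Phi> y) / (klein_scale (\<Phi> x) * klein_scale (\<Phi> y)) =
      (1 - x \<bullet> y) / (klein_scale x * klein_scale y)"
    unfolding klein_scale_def using c(2) by (intro hdist_eq_iff) auto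
qed

text \<open>\<open>boundary_factor \<Phi> u\<close> is the limit of \<open>klein_scale (\<Phi> y) / klein_scale y\<close> as \<open>y\<close> tends
    radially to \<open>u\<close>.\<close>

definition boundary_factor :: "(real^3 \<Rightarrow> real^3) \<Rightarrow> real^3 \<Rightarrow> real"
  where "boundary_factor \<Phi> u = (1 - \<Phi> 0 \<bullet> \<Phi> u) / klein_scale (\<Phi> 0)"

lemma radial_sequence:
  assumes "norm (u::real^3) = 1"
  obtains y where "\<And>n. y n \<in> H3" "y \<longlonglongrightarrow> u"
proof
  show "(1 - inverse (real (Suc n))) *\<^sub>R u \<in> H3" for n
    using assms(1) by (simp add: inverse_eq_divide)
  have "(\<lambda>n. (1 - inverse (real (Suc n))) *\<^sub>R u) \<longlonglongrightarrow> (1 - 0) *\<^sub>R u"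
    by (intro tendsto_intros LIMSEQ_inverse_real_of_nat)
  then show "(\<lambda>n. (1 - inverse (real (Suc n))) *\<^sub>R u) \<longlonglongrightarrow> u" by simp
qed

lemma tendsto_Isom:
  assumes "continuous_on (cball 0 1) \<Phi>" "\<And>n. y n \<in> (H3)" "y \<longlonglongrightarrow> u"
  shows "(\<lambda>n. \<Phi> (y n)) \<longlonglongrightarrow> \<Phi> (u::real^3)"
proof -
  have "u \<in> cball 0 1"
    using closed_sequentially[OF closed_cball, of y 0 1 u] assms(2,3) by (auto simp: less_imp_le)
  then show ?thesis
    using assms continuous_on_tendsto_compose[OF assms(1,3)]
    by (auto simp: less_imp_le)
qed

lemma Isom_cball:
  assumes "\<Phi> \<in> Isom_plus" "norm u = 1"
  shows "norm (\<Phi> u) \<le> 1"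
proof -
  obtain y where y: "\<And>n. y n \<in> H3" "y \<longlonglongrightarrow> u" using radial_sequence[OF assms(2)] by blast
  have "(\<lambda>n. \<Phi> (y n)) \<longlonglongrightarrow> \<Phi> u"
    by (rule tendsto_Isom[OF Isom_plusD(1)[OF assms(1)] y])
  moreover have "\<Phi> (y n) \<in> cball 0 1" for n
    using Isom_plusD(2)[OF assms(1) y(1)[of n]] by auto
  ultimately have "\<Phi> u \<in> cball 0 1"
    using closed_sequentially[OF closed_cball] by metis
  then show ?thesis by simp
qed

lemma boundary_factor_pos:
  assumes "\<Phi> \<in> Isom_plus" "norm u = 1"
  shows "0 < boundary_factor \<Phi> u"
  unfolding boundary_factor_def
  using Isom_plusD(2)[OF assms(1), of 0] Isom_cball[OF assms]
  by (intro divide_pos_pos one_minus_inner_pos klein_scale_pos) auto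

text \<open>The second point of the isometry condition runs to the sphere, where
  \<open>klein_scale\<close> tends to 0. Only the ratio \<open>s\<close> of its scales enters, and
  comparing \<open>x\<close> with the base point 0 eliminates it before the limit is taken.\<close>

lemma Isom_interior_boundary:
  assumes \<Phi>: "\<Phi> \<in> Isom_plus" and u: "norm u = 1" and x: "x \<in> H3"
  shows "(1 - \<Phi> x \<bullet> \<Phi> u) / klein_scale (\<Phi> x) = boundary_factor \<Phi> u * ((1 - x \<bullet> u) / klein_scale x)"
proof -
  obtain y where y: "\<And>n. y n \<in> H3" "y \<longlonglongrightarrow> u" using radial_sequence[OF u] by blast
  have lim: "(\<lambda>n. \<Phi> (y n)) \<longlonglongrightarrow> \<Phi> u"
    by (rule tendsto_Isom[OF Isom_plusD(1)[OF \<Phi>] y])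
  have key: "(1 - \<Phi> x \<bullet> \<Phi> (y n)) / klein_scale (\<Phi> x) * (1 - 0 \<bullet> y n) =
     (1 - \<Phi> 0 \<bullet> \<Phi> (y n)) / klein_scale (\<Phi> 0) * ((1 - x \<bullet> y n) / klein_scale x)" for n
  proof -
    define s where "s = klein_scale (\<Phi> (y n)) / klein_scale (y n)"
    have 0: "klein_scale 0 = 1" "(0::real^3) \<in> H3" by (auto simp: klein_scale_def)
    have p: "klein_scale (\<Phi> x) > 0" "klein_scale x > 0" "klein_scale (\<Phi> 0) > 0"
        "klein_scale (y n) > 0" "klein_scale (\<Phi> (y n)) > 0"
      by (auto intro!: klein_scale_pos Isom_plusD(2)[OF \<Phi>] x y 0)
    have "(1 - \<Phi> x \<bullet> \<Phi> (y n)) / klein_scale (\<Phi> x) = s * ((1 - x \<bullet> y n) / klein_scale x)"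
      using Isom_plusD(3)[OF \<Phi> x y(1)[of n]] p by (simp add: s_def field_simps)
    moreover have "(1 - \<Phi> 0 \<bullet> \<Phi> (y n)) / klein_scale (\<Phi> 0) = s * (1 - 0 \<bullet> y n)"
      using Isom_plusD(3)[OF \<Phi> 0(2) y(1)[of n]] p by (simp add: s_def 0 field_simps)
    ultimately show ?thesis by simp
  qed
  have a: "(\<lambda>n. (1 - \<Phi> x \<bullet> \<Phi> (y n)) / klein_scale (\<Phi> x) * (1 - 0 \<bullet> y n)) \<longlonglongrightarrow>
      (1 - \<Phi> x \<bullet> \<Phi> u) / klein_scale (\<Phi> x) * (1 - 0 \<bullet> u)"
    by (intro tendsto_intros lim y) (use klein_scale_pos[OF Isom_plusD(2)[OF \<Phi> x]] in auto)
  have b: "(\<lambda>n. (1 - \<Phi> 0 \<bullet> \<Phi> (y n)) / klein_scale (\<Phi> 0) * ((1 - x \<bullet> y n) / klein_scale x)) \<longlonglongrightarrow>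
      (1 - \<Phi> 0 \<bullet> \<Phi> u) / klein_scale (\<Phi> 0) * ((1 - x \<bullet> u) / klein_scale x)"
    by (intro tendsto_intros lim y)
       (use klein_scale_pos[OF Isom_plusD(2)[OF \<Phi>, of 0]] klein_scale_pos[OF x] in auto)
  show ?thesis
    using LIMSEQ_unique[OF a b[folded key]] by (simp add: boundary_factor_def)
qed

text \<open>The other point runs to the sphere as well. The distortion is a product of one factor
  per point, hence cancels in absolute values of cross ratios.\<close>

lemma Isom_boundary:
  assumes \<Phi>: "\<Phi> \<in> Isom_plus" and u: "norm u = 1" and v: "norm v = 1"
  shows "1 - \<Phi> v \<bullet> \<Phi> u = boundary_factor \<Phi> v * boundary_factor \<Phi> u * (1 - v \<bullet> u)"
proof -
  obtain y where y: "\<And>n. y n \<in> H3" "y \<longlonglongrightarrow> v" using radial_sequence[OF v] by blast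
  have lim: "(\<lambda>n. \<Phi> (y n)) \<longlonglongrightarrow> \<Phi> v"
    by (rule tendsto_Isom[OF Isom_plusD(1)[OF \<Phi>] y])
  have 0: "klein_scale 0 = 1" "(0::real^3) \<in> H3" by (auto simp: klein_scale_def)
  have p0: "klein_scale (\<Phi> 0) > 0" by (auto intro!: klein_scale_pos Isom_plusD(2)[OF \<Phi>] 0)
  have key: "(1 - \<Phi> (y n) \<bullet> \<Phi> u) = (1 - \<Phi> 0 \<bullet> \<Phi> (y n)) / klein_scale (\<Phi> 0) *
      (boundary_factor \<Phi> u * (1 - y n \<bullet> u))" for n
  proof -
    define s where "s = klein_scale (\<Phi> (y n)) / klein_scale (y n)"
    have p: "klein_scale (y n) > 0" "klein_scale (\<Phi> (y n)) > 0"
      by (auto intro!: klein_scale_pos Isom_plusD(2)[OF \<Phi>] y)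
    have "1 - \<Phi> (y n) \<bullet> \<Phi> u = s * (boundary_factor \<Phi> u * (1 - y n \<bullet> u))"
      using Isom_interior_boundary[OF \<Phi> u y(1)[of n]] p by (simp add: s_def field_simps)
    moreover have "(1 - \<Phi> 0 \<bullet> \<Phi> (y n)) / klein_scale (\<Phi> 0) = s"
      using Isom_plusD(3)[OF \<Phi> 0(2) y(1)[of n]] p p0 by (simp add: s_def 0 field_simps)
    ultimately show ?thesis by simp
  qed
  have a: "(\<lambda>n. 1 - \<Phi> (y n) \<bullet> \<Phi> u) \<longlonglongrightarrow> 1 - \<Phi> v \<bullet> \<Phi> u"
    by (intro tendsto_intros lim)
  have b: "(\<lambda>n. (1 - \<Phi> 0 \<bullet> \<Phi> (y n)) / klein_scale (\<Phi> 0) * (boundary_factor \<Phi> u * (1 - y n \<bullet> u))) \<longlonglongrightarrow>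
      (1 - \<Phi> 0 \<bullet> \<Phi> v) / klein_scale (\<Phi> 0) * (boundary_factor \<Phi> u * (1 - v \<bullet> u))"
    by (intro tendsto_intros lim y) (use p0 in auto)
  show ?thesis
    using LIMSEQ_unique[OF a b[folded key]] by (simp add: boundary_factor_def[of \<Phi> v])
qed

lemma Isom_sphere:
  assumes \<Phi>: "\<Phi> \<in> Isom_plus" and u: "norm u = 1"
  shows "norm (\<Phi> u) = 1"
  using Isom_boundary[OF \<Phi> u u] u by (simp add: norm_eq_1)

section \<open>Orientation of four ideal points and the imaginary part of their cross ratio\<close>

definition orient :: "real^3 \<Rightarrow> real^3 \<Rightarrow> real^3 \<Rightarrow> real^3 \<Rightarrow> real"
  where "orient u0 u1 u2 u3 = det (vector [u1 - u0, u2 - u0, u3 - u0] :: real^3^3)"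

lemma det_vec3:
  "det (vector [a, b, c] :: real^3^3) =
    a $ 1 * (b $ 2 * c $ 3 - b $ 3 * c $ 2) - a $ 2 * (b $ 1 * c $ 3 - b $ 3 * c $ 1)
    + a $ 3 * (b $ 1 * c $ 2 - b $ 2 * c $ 1)"
  by (simp add: det_3 algebra_simps)

text \<open>In the 4x4 determinant of the rows \<open>(1, v_i)\<close> a column operation replaces 1
  by \<open>d v_i\<close>. Clearing that column with the pivot \<open>d v0\<close> leaves the 3x3
  determinant and the factor \<open>(d v0)\<^sup>2\<close>.\<close>

lemma orient_projective:
  fixes y v0 v1 v2 v3 :: "real^3"
  defines "d \<equiv> \<lambda>v. 1 - y \<bullet> v"
  shows "det (vector [d v0 *\<^sub>R v1 - d v1 *\<^sub>R v0, d v0 *\<^sub>R v2 - d v2 *\<^sub>R v0,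
    d v0 *\<^sub>R v3 - d v3 *\<^sub>R v0] :: real^3^3) = (d v0)\<^sup>2 * orient v0 v1 v2 v3"
proof -
  define t where "t a b c = det (vector [a, b, c] :: real^3^3)" for a b c
  have 1: "t (d v0 *\<^sub>R v1 - d v1 *\<^sub>R v0) (d v0 *\<^sub>R v2 - d v2 *\<^sub>R v0) (d v0 *\<^sub>R v3 - d v3 *\<^sub>R v0)
     = (d v0)\<^sup>2 * (d v0 * t v1 v2 v3 - d v1 * t v0 v2 v3 - d v2 * t v1 v0 v3 - d v3 * t v1 v2 v0)"
    unfolding t_def det_vec3
    by (simp add: algebra_simps power2_eq_square)
  have 2: "d v0 * t v1 v2 v3 - d v1 * t v0 v2 v3 - d v2 * t v1 v0 v3 - d v3 * t v1 v2 v0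
     = orient v0 v1 v2 v3"
    unfolding t_def det_vec3 orient_def d_def inner_vec3
    by (simp add: algebra_simps)
  show ?thesis using 1[unfolded 2] unfolding t_def .
qed

text \<open>An isometry is projective, and differentiating this at the origin shows that the
  transposed derivative takes \<open>W i\<close> to a positive multiple of \<open>u i - u 0\<close>.
  Taking determinants, the positive Jacobian carries the orientation over to the sphere.\<close>

lemma orient_Isom:
  assumes \<Phi>: "\<Phi> \<in> Isom_plus" and u: "\<And>i. i < 4 \<Longrightarrow> norm (u i) = 1"
  obtains k where "k > 0"
    "orient (\<Phi> (u 0)) (\<Phi> (u 1)) (\<Phi> (u 2)) (\<Phi> (u 3)) = k * orient (u 0) (u 1) (u 2) (u (3::nat))"
proof -
  have 0: "(0::real^3) \<in> H3" by simp
  obtain \<Phi>' where \<Phi>': "(\<Phi> has_derivative \<Phi>') (at 0)" and pos: "0 < det (matrix \<Phi>')"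
    using Isom_plusD(4)[OF \<Phi> 0] by blast
  define v where "v i = \<Phi> (u i)" for i
  define d where "d i = 1 - \<Phi> 0 \<bullet> v i" for i
  define W where "W i = d 0 *\<^sub>R v i - d i *\<^sub>R v 0" for i
  have d: "d i > 0" if "i < 4" for i
    unfolding d_def v_def
    by (rule one_minus_inner_pos[OF Isom_plusD(2)[OF \<Phi> 0] Isom_cball[OF \<Phi> u[OF that]]])
  \<comment> \<open>The relation of \<open>Isom_interior_boundary\<close> for \<open>u i\<close>
    divided by that for \<open>u 0\<close>, cleared of denominators: \<open>klein_scale\<close>
    drops out and an identity that can be differentiated remains.\<close>
  have eq: "(1 - \<Phi> x \<bullet> v i) * (d 0 * (1 - x \<bullet> u 0)) = (1 - \<Phi> x \<bullet> v 0) * (d i * (1 - x \<bullet> u i))"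
    if "i < 4" "x \<in> H3" for i x
  proof -
    have p: "klein_scale (\<Phi> x) > 0" "klein_scale x > 0" "klein_scale (\<Phi> 0) > 0"
      using klein_scale_pos that(2) Isom_plusD(2)[OF \<Phi> that(2)] Isom_plusD(2)[OF \<Phi> 0] by blast+
    define r where "r = klein_scale (\<Phi> x) / (klein_scale x * klein_scale (\<Phi> 0))"
    have "1 - \<Phi> x \<bullet> v j = r * (d j * (1 - x \<bullet> u j))" if "j < 4" for j
      using Isom_interior_boundary[OF \<Phi> u[OF that] \<open>x \<in> H3\<close>] p
      by (simp add: r_def d_def v_def boundary_factor_def field_simps)
    from this[OF \<open>i < 4\<close>] this[of 0] show ?thesis by simp
  qed
  have deriv: "\<Phi>' h \<bullet> W i = d i * d 0 * (h \<bullet> (u i - u 0))" if i: "i < 4" for i h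
  proof -
    define F where "F x = (1 - \<Phi> x \<bullet> v i) * (d 0 * (1 - x \<bullet> u 0)) - (1 - \<Phi> x \<bullet> v 0) *
        (d i * (1 - x \<bullet> u i))" for x
    have F1: "(F has_derivative (\<lambda>h. - (\<Phi>' h \<bullet> v i) * d 0 - d i * d 0 * (h \<bullet> u 0)
        + (\<Phi>' h \<bullet> v 0) * d i + d 0 * d i * (h \<bullet> u i))) (at 0)"
      unfolding F_def
      by (rule derivative_eq_intros \<Phi>' refl)+ (simp add: fun_eq_iff d_def[symmetric] algebra_simps)
    \<comment> \<open>\<open>F\<close> vanishes on the whole ball, so the derivative computed in
      \<open>F1\<close> is zero.\<close>
    have F2: "(F has_derivative (\<lambda>h. 0)) (at 0)"
      by (rule has_derivative_transform_within_open[of "\<lambda>x. 0" _ 0 UNIV H3])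
         (use eq[OF i] in \<open>auto simp: F_def\<close>)
    have "- (\<Phi>' h \<bullet> v i) * d 0 - d i * d 0 * (h \<bullet> u 0)
        + (\<Phi>' h \<bullet> v 0) * d i + d 0 * d i * (h \<bullet> u i) = 0"
      using has_derivative_unique[OF F1 F2] by (rule fun_cong)
    then show ?thesis by (simp add: W_def inner_diff_right algebra_simps)
  qed
  have lin: "linear \<Phi>'" using \<Phi>' by (rule has_derivative_linear)
  have comp: "(w v* matrix \<Phi>') = r *\<^sub>R z" if "\<And>h. \<Phi>' h \<bullet> w = r * (h \<bullet> z)" for w z :: "real^3" and r
  proof (rule vector_eq_rdot[THEN iffD1], rule allI)
    fix h
    have "(w v* matrix \<Phi>') \<bullet> h = w \<bullet> (matrix \<Phi>' *v h)"
      by (simp add: dot_lmul_matrix)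
    also have "\<dots> = \<Phi>' h \<bullet> w"
      by (simp add: lin inner_commute)
    finally show "(w v* matrix \<Phi>') \<bullet> h = (r *\<^sub>R z) \<bullet> h"
      by (simp add: that) (simp add: inner_commute)
  qed
  have rows: "(vector [a, b, c] :: real^3^3) ** N = vector [a v* N, b v* N, c v* N]"
      for a b c and N :: "real^3^3"
    by (simp add: vec_eq_iff forall_3 matrix_matrix_mult_def vector_matrix_mult_def
        sum_3 mult.commute)
  have "det (vector [W 1, W 2, W 3] :: real^3^3) * det (matrix \<Phi>') =
      det (vector [W 1 v* matrix \<Phi>', W 2 v* matrix \<Phi>', W 3 v* matrix \<Phi>'] :: real^3^3)"
    by (simp add: det_mul[symmetric] rows)
  also have "\<dots> = det (vector [(d 1 * d 0) *\<^sub>R (u 1 - u 0), (d 2 * d 0) *\<^sub>R (u 2 - u 0),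
      (d 3 * d 0) *\<^sub>R (u 3 - u 0)] :: real^3^3)"
    by (subst (1 2 3) comp[OF deriv]) auto
  also have "\<dots> = (d 1 * d 2 * d 3 * d 0 ^ 3) * orient (u 0) (u 1) (u 2) (u 3)"
    unfolding orient_def det_vec3 by (simp add: algebra_simps power3_eq_cube)
  finally have "(d 0)\<^sup>2 * orient (v 0) (v 1) (v 2) (v 3) * det (matrix \<Phi>') =
      (d 1 * d 2 * d 3 * d 0 ^ 3) * orient (u 0) (u 1) (u 2) (u 3)"
    using orient_projective[of "\<Phi> 0" "v 0" "v 1" "v 2" "v 3"] by (simp add: W_def d_def)
  then have e: "orient (v 0) (v 1) (v 2) (v 3) =
      (d 1 * d 2 * d 3 * d 0 / det (matrix \<Phi>')) * orient (u 0) (u 1) (u 2) (u 3)"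
    using d[of 0] pos by (simp add: field_simps power2_eq_square power3_eq_cube)
  show ?thesis
    by (rule that[OF _ e[unfolded v_def]]) (simp add: d pos)
qed

definition minor3 :: "(nat \<Rightarrow> 'a::comm_ring_1) \<Rightarrow> (nat \<Rightarrow> 'a) \<Rightarrow> (nat \<Rightarrow> 'a) \<Rightarrow> nat \<Rightarrow> nat \<Rightarrow> nat \<Rightarrow> 'a"
  where "minor3 f g h i j k = f i * (g j * h k - g k * h j) - f j * (g i * h k - g k * h i) + f k
      * (g i * h j - g j * h i)"

text \<open>Laplace expansion of the determinant with rows \<open>f\<close>, \<open>g\<close>,
  \<open>h\<close>, \<open>k\<close> and columns 0 to 3, explicit so that determinant identities
  become polynomial identities.\<close>

definition det4 :: "(nat \<Rightarrow> 'a::comm_ring_1) \<Rightarrow> (nat \<Rightarrow> 'a) \<Rightarrow> (nat \<Rightarrow> 'a) \<Rightarrow> (nat \<Rightarrow> 'a) \<Rightarrow> 'a"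
  where "det4 f g h k = f 0 * minor3 g h k 1 2 3 - f 1 * minor3 g h k 0 2 3 + f 2 * minor3 g h k 0
      1 3 - f 3 * minor3 g h k 0 1 2"

text \<open>The cross ratio \<open>[01] [23] / ([02] [13])\<close> of four points, multiplied
    by \<open>\<bar>[02] [13]\<bar>\<^sup>2\<close> to avoid
  division.\<close>

definition scaled_cross_ratio :: "(nat \<Rightarrow> complex^2) \<Rightarrow> complex"
  where "scaled_cross_ratio a = cross2 (a 0) (a 1) * cross2 (a 2) (a 3) * cnj
      (cross2 (a 0) (a 2) * cross2 (a 1) (a 3))"

lemma orient_scaled:
  assumes "\<And>i. i < 4 \<Longrightarrow> n i \<noteq> 0"
  shows "n 0 * n 1 * n 2 * n 3 *
     orient ((1 / n 0) *\<^sub>R vector [x 0, y 0, z 0]) ((1 / n 1) *\<^sub>R vector [x 1, y 1, z 1])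
      ((1 / n 2) *\<^sub>R vector [x 2, y 2, z 2]) ((1 / n 3) *\<^sub>R vector [x 3, y 3, z 3]) = det4 n x y z"
proof -
  have n: "n 0 \<noteq> 0" "n 1 \<noteq> 0" "n 2 \<noteq> 0" "n 3 \<noteq> 0" using assms by auto
  define x' y' z' where "x' i = x i / n i" and "y' i = y i / n i" and "z' i = z i / n i" for i
  have s: "x i = n i * x' i" "y i = n i * y' i" "z i = n i * z' i" if "i < 4" for i
    using assms[OF that] by (auto simp: x'_def y'_def z'_def)
  have "orient ((1 / n 0) *\<^sub>R vector [x 0, y 0, z 0]) ((1 / n 1) *\<^sub>R vector [x 1, y 1, z 1])
      ((1 / n 2) *\<^sub>R vector [x 2, y 2, z 2]) ((1 / n 3) *\<^sub>R vector [x 3, y 3, z 3]) =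
     minor3 x' y' z' 1 2 3 - minor3 x' y' z' 0 2 3 + minor3 x' y' z' 0 1 3 - minor3 x' y' z' 0 1 2"
    unfolding orient_def det_vec3 minor3_def
    by (simp add: x'_def[symmetric] y'_def[symmetric] z'_def[symmetric]) (simp add: algebra_simps)
  then show ?thesis
    unfolding det4_def minor3_def by (simp add: s) (simp add: algebra_simps)
qed

text \<open>Row operations: two factors 2, an even permutation, and -2 for passing from
  \<open>p\<close>, \<open>q\<close> to \<open>p + q\<close>, \<open>p - q\<close>.\<close>

lemma det4_sum_diff:
  "det4 (\<lambda>i. p i + q i) (\<lambda>i. 2 * x i) (\<lambda>i. 2 * y i) (\<lambda>i. p i - q i) =
      - 8 * det4 p q x (y :: nat \<Rightarrow> real)"
  unfolding det4_def minor3_def by (simp add: algebra_simps)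

text \<open>The columns are the tensors of \<open>(a, b)\<close> and
  \<open>(\<alpha>, \<beta>)\<close>; their determinant compares the cross ratios of the two
  quadruples. When the second is the conjugate of the first, an imaginary part results.\<close>

lemma det4_hermitian:
  fixes a b \<alpha> \<beta> :: "nat \<Rightarrow> complex"
  shows "det4 (\<lambda>i. a i * \<alpha> i) (\<lambda>i. b i * \<beta> i) (\<lambda>i. a i * \<beta> i) (\<lambda>i. b i * \<alpha> i) =
    (\<alpha> 0 * \<beta> 1 - \<beta> 0 * \<alpha> 1) * (\<alpha> 2 * \<beta> 3 - \<beta> 2 * \<alpha> 3) * ((a 0 * b 2 - b 0 * a 2) *
        (a 1 * b 3 - b 1 * a 3))
  - (a 0 * b 1 - b 0 * a 1) * (a 2 * b 3 - b 2 * a 3) * ((\<alpha> 0 * \<beta> 2 - \<beta> 0 * \<alpha> 2) *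
      (\<alpha> 1 * \<beta> 3 - \<beta> 1 * \<alpha> 3))"
  unfolding det4_def minor3_def by (simp add: algebra_simps)

text \<open>The change of rows from real and imaginary part to \<open>w\<close> and
  \<open>cnj w\<close> has determinant \<open>-2 * \<i>\<close>.\<close>

lemma det4_Re_Im:
  "complex_of_real (det4 p q (\<lambda>i. Re (w i)) (\<lambda>i. Im (w i))) =
    \<i> / 2 * det4 (\<lambda>i. complex_of_real (p i)) (\<lambda>i. complex_of_real (q i)) w (\<lambda>i. cnj (w i))"
proof -
  define x y where "x i = Re (w i)" and "y i = Im (w i)" for i
  have w: "w i = complex_of_real (x i) + \<i> * complex_of_real (y i)"
    "cnj (w i) = complex_of_real (x i) - \<i> * complex_of_real (y i)" for i
    by (simp_all add: complex_eq_iff x_def y_def)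
  show ?thesis
    unfolding det4_def minor3_def w x_def[symmetric] y_def[symmetric]
    by (simp add: algebra_simps)
qed

text \<open>Up to row operations, the homogeneous coordinates of the Hopf map are the entries of the
  Hermitian matrix of rank one built from \<open>a i\<close>, so \<open>det4_hermitian\<close>
  applies.\<close>

lemma orient_ideal_point:
  assumes "\<And>i. i < 4 \<Longrightarrow> a i \<noteq> 0"
  shows "(norm (a 0))\<^sup>2 * (norm (a 1))\<^sup>2 * (norm (a 2))\<^sup>2 * (norm (a 3))\<^sup>2 *
    orient (ideal_point (a 0)) (ideal_point (a 1)) (ideal_point (a 2)) (ideal_point (a 3)) =
        - 8 * Im (scaled_cross_ratio a)"
proof -
  define p q w where "p i = (cmod (a i $ 1))\<^sup>2" and "q i = (cmod (a i $ 2))\<^sup>2"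
    and "w i = a i $ 1 * cnj (a i $ 2)" for i
  have c: "complex_of_real (p i) = a i $ 1 * cnj (a i $ 1)" "complex_of_real (q i) =
      a i $ 2 * cnj (a i $ 2)"
     "cnj (w i) = a i $ 2 * cnj (a i $ 1)" for i
    unfolding p_def q_def w_def complex_norm_square by (simp_all add: mult.commute)
  have n: "(norm (a i))\<^sup>2 = p i + q i" for i by (simp add: norm_power2_complex2 p_def q_def)
  have "complex_of_real (det4 p q (\<lambda>i. Re (w i)) (\<lambda>i. Im (w i))) =
      \<i> / 2 * (cnj (scaled_cross_ratio a) - scaled_cross_ratio a)"
    unfolding det4_Re_Im c
    by (simp add: w_def det4_hermitian scaled_cross_ratio_def cross2_def)
  also have "\<dots> = complex_of_real (Im (scaled_cross_ratio a))"
    by (simp add: complex_eq_iff)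
  finally have D: "det4 p q (\<lambda>i. Re (w i)) (\<lambda>i. Im (w i)) = Im (scaled_cross_ratio a)"
    by (simp only: of_real_eq_iff)
  have "(norm (a 0))\<^sup>2 * (norm (a 1))\<^sup>2 * (norm (a 2))\<^sup>2 * (norm (a 3))\<^sup>2 *
    orient (ideal_point (a 0)) (ideal_point (a 1)) (ideal_point (a 2)) (ideal_point (a 3)) =
     det4 (\<lambda>i. p i + q i) (\<lambda>i. 2 * Re (w i)) (\<lambda>i. 2 * Im (w i)) (\<lambda>i. p i - q i)"
    unfolding ideal_point_def p_def[symmetric] q_def[symmetric] w_def[symmetric] n
    by (rule orient_scaled) (use assms n in \<open>metis norm_eq_zero zero_eq_power2\<close>)
  then show ?thesis by (simp add: det4_sum_diff D)
qed

section \<open>Matrices acting on ideal points\<close>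

lemma det_complex2: "det (A :: complex^2^2) = A $ 1 $ 1 * A $ 2 $ 2 - A $ 1 $ 2 * A $ 2 $ 1"
  by (simp add: det_2)

lemma matrix_vector_2:
  fixes A :: "complex^2^2"
  shows "(A *v v) $ 1 = A $ 1 $ 1 * v $ 1 + A $ 1 $ 2 * v $ 2"
  "(A *v v) $ 2 = A $ 2 $ 1 * v $ 1 + A $ 2 $ 2 * v $ 2"
  by (simp_all add: matrix_vector_mult_def sum_2)

lemma cross2_matrix: "cross2 (A *v u) (A *v v) = det A * cross2 u v"
  unfolding cross2_def matrix_vector_2 det_complex2 by (simp add: algebra_simps)

lemma matrix_vector_nonzero:
  fixes A :: "complex^2^2"
  assumes "det A \<noteq> 0" "v \<noteq> 0" shows "A *v v \<noteq> 0"
  using assms by (metis invertible_det_nz matrix_left_invertible_ker invertible_def)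

lemma ideal_point_scale: "c \<noteq> 0 \<Longrightarrow> v \<noteq> 0 \<Longrightarrow> ideal_point (c *s v) = ideal_point v"
  by (subst ideal_point_eq_iff) (auto simp: cross2_def)

lemma ideal_point_matrix_cong:
  assumes "det A \<noteq> 0" "u \<noteq> 0" "v \<noteq> 0" "ideal_point u = ideal_point v"
  shows "ideal_point (A *v u) = ideal_point (A *v v)"
  using assms by (simp add: ideal_point_eq_iff matrix_vector_nonzero cross2_matrix)

lemma scaled_cross_ratio_matrix:
  "scaled_cross_ratio (\<lambda>i. A *v a i) = complex_of_real ((cmod (det A)) ^ 4) * scaled_cross_ratio a"
proof -
  have "complex_of_real ((cmod (det A)) ^ 4) = (det A * cnj (det A))\<^sup>2"
    unfolding complex_norm_square[symmetric] by simp
  then show ?thesis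
    unfolding scaled_cross_ratio_def cross2_matrix by (simp add: power2_eq_square)
qed

lemma Isom_cross2:
  assumes \<Phi>: "\<Phi> \<in> Isom_plus" and nz: "u \<noteq> 0" "v \<noteq> 0" "u' \<noteq> 0" "v' \<noteq> 0"
    and "\<Phi> (ideal_point u) = ideal_point u'" "\<Phi> (ideal_point v) = ideal_point v'"
  shows "(cmod (cross2 u' v'))\<^sup>2 =
    (boundary_factor \<Phi> (ideal_point u) * (norm u')\<^sup>2 / (norm u)\<^sup>2) *
        (boundary_factor \<Phi> (ideal_point v) * (norm v')\<^sup>2 / (norm v)\<^sup>2) *
    (cmod (cross2 u v))\<^sup>2"
proof -
  have "1 - ideal_point u' \<bullet> ideal_point v' = boundary_factor \<Phi> (ideal_point u) * boundary_factor
      \<Phi> (ideal_point v) * (1 - ideal_point u \<bullet> ideal_point v)"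
    using Isom_boundary[OF \<Phi> norm_ideal_point[OF nz(2)] norm_ideal_point[OF nz(1)]] assms by simp
  then show ?thesis
    unfolding one_minus_inner_ideal_point[OF nz(1,2)] one_minus_inner_ideal_point[OF nz(3,4)]
    using nz by (simp add: field_simps)
qed

text \<open>Homogeneous coordinates of the normalized vertices \<open>(0, 1, \<infinity>, z)\<close>.\<close>

definition frame_vec :: "complex \<Rightarrow> nat \<Rightarrow> complex^2"
  where "frame_vec z i = (if i = 0 then vector [0, 1] else if i = 1 then vector [1, 1]
     else if i = 2 then vector [1, 0] else vector [z, 1])"

lemma frame_vec_nth [simp]:
  "frame_vec z 0 $ 1 = 0" "frame_vec z 0 $ 2 = 1" "frame_vec z (Suc 0) $ 1 = 1"
      "frame_vec z (Suc 0) $ 2 = 1"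
  "frame_vec z 2 $ 1 = 1" "frame_vec z 2 $ 2 = 0" "frame_vec z 3 $ 1 = z" "frame_vec z 3 $ 2 = 1"
  by (simp_all add: frame_vec_def)

lemma frame_vec_nonzero [simp]: "frame_vec z i \<noteq> 0"
  by (auto simp: frame_vec_def vec2_eq_iff)

text \<open>The columns must be multiples of \<open>b 2\<close> and \<open>b 0\<close>, the images
  of infinity and 0; Cramer's rule gives the weights \<open>s\<close> and \<open>t\<close> for which
  they add up to \<open>b 1\<close>.\<close>

lemma matrix_through_three_points:
  fixes b :: "nat \<Rightarrow> complex^2"
  assumes "cross2 (b 0) (b 1) \<noteq> 0" "cross2 (b 0) (b 2) \<noteq> 0" "cross2 (b 1) (b 2) \<noteq> 0"
  obtains A :: "complex^2^2" where "det A \<noteq> 0" "\<And>i. i < 3 \<Longrightarrow> ideal_point (A *v frame_vec z i) =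
      ideal_point (b i)"
proof -
  define s t where "s = cross2 (b 1) (b 0) / cross2 (b 2) (b 0)"
      and "t = cross2 (b 1) (b 2) / cross2 (b 0) (b 2)"
  define A :: "complex^2^2" where
    "A = vector [vector [s * b 2 $ 1, t * b 0 $ 1], vector [s * b 2 $ 2, t * b 0 $ 2]]"
  have anti: "cross2 (b 2) (b 0) = - cross2 (b 0) (b 2)" "cross2 (b 1) (b 0) = - cross2 (b 0) (b 1)"
    by (simp_all add: cross2_def)
  have st: "s \<noteq> 0" "t \<noteq> 0" using assms anti by (auto simp: s_def t_def)
  have nz: "b 0 \<noteq> 0" "b 1 \<noteq> 0" "b 2 \<noteq> 0"
    using assms by (auto simp: cross2_def)
  have "det A = s * t * cross2 (b 2) (b 0)"
    by (simp add: det_complex2 A_def cross2_def algebra_simps)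
  then have d: "det A \<noteq> 0" using st assms by (simp add: anti)
  have A0: "A *v frame_vec z 0 = t *s b 0" and A2: "A *v frame_vec z 2 = s *s b 2"
    by (simp_all add: vec2_eq_iff matrix_vector_2 A_def)
  have A1: "A *v frame_vec z 1 = b 1"
  proof -
    have "cross2 (b 0) (b 2) * b 1 $ k = cross2 (b 0) (b 1) * b 2 $ k + cross2 (b 1)
        (b 2) * b 0 $ k"
      if "k = 1 \<or> k = 2" for k :: 2
      using that by (auto simp: cross2_def algebra_simps)
    then have "b 1 $ k = s * b 2 $ k + t * b 0 $ k" if "k = 1 \<or> k = 2" for k :: 2
      using that assms anti by (simp add: s_def t_def field_simps)
    then show ?thesis
      by (simp add: vec2_eq_iff matrix_vector_2 A_def)
  qed
  have "ideal_point (A *v frame_vec z i) = ideal_point (b i)" if "i < 3" for i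
  proof -
    have "i = 0 \<or> i = 1 \<or> i = 2" using that by auto
    then show ?thesis using A0 A1 A2 ideal_point_scale st nz by auto
  qed
  with d show ?thesis by (rule that)
qed

text \<open>A matrix \<open>A\<close> is fitted to \<open>\<Phi>\<close> at 0, 1 and infinity.
  Absolute cross ratios with these three points locate any other point up to complex conjugation,
  and orientation removes this ambiguity.\<close>

theorem Isom_plus_Moebius:
  assumes \<Phi>: "\<Phi> \<in> Isom_plus"
  obtains A :: "complex^2^2" where "det A \<noteq> 0" "\<And>a. a \<noteq> 0 \<Longrightarrow> \<Phi> (ideal_point a) =
      ideal_point (A *v a)"
proof -
  \<comment> \<open>The indices 0, 1, 2 stand for 0, 1 and infinity; the argument 0 does not affect
    them.\<close>
  define e where "e = frame_vec 0"
  have e: "e i \<noteq> 0" for i by (simp add: e_def)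
  have "\<exists>b. b \<noteq> 0 \<and> ideal_point b = \<Phi> (ideal_point a)" if "a \<noteq> 0" for a
    using ideal_point_surj[OF Isom_sphere[OF \<Phi> norm_ideal_point[OF that]]] by metis
  then obtain B where B: "\<And>a. a \<noteq> 0 \<Longrightarrow> B a \<noteq> 0 \<and> ideal_point (B a) = \<Phi> (ideal_point a)" by metis
  define \<mu> where "\<mu> a = boundary_factor \<Phi> (ideal_point a) / (norm a)\<^sup>2" for a
  have \<mu>: "\<mu> a > 0" if "a \<noteq> 0" for a
    unfolding \<mu>_def using boundary_factor_pos[OF \<Phi> norm_ideal_point[OF that]] that by simp
  have gram: "(cmod (cross2 u' v'))\<^sup>2 = (\<mu> u * (norm u')\<^sup>2) * (\<mu> v * (norm v')\<^sup>2) *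
      (cmod (cross2 u v))\<^sup>2"
    if "u \<noteq> 0" "v \<noteq> 0" "u' \<noteq> 0" "v' \<noteq> 0" "\<Phi> (ideal_point u) = ideal_point u'" "\<Phi> (ideal_point v) =
        ideal_point v'" for u v u' v'
    using Isom_cross2[OF \<Phi> that] by (simp add: \<mu>_def)
  have cB: "cross2 (B (e i)) (B (e j)) \<noteq> 0" if "cross2 (e i) (e j) \<noteq> 0" for i j
    using gram[OF e e, of "B (e i)" "B (e j)" i j] B[OF e] \<mu>[OF e] that
    by (metis less_irrefl mult_eq_0_iff norm_eq_zero zero_eq_power2)
  obtain A :: "complex^2^2" where A: "det A \<noteq> 0" "\<And>i. i < 3 \<Longrightarrow> ideal_point (A *v e i) =
      ideal_point (B (e i))"
    using matrix_through_three_points[of "\<lambda>i. B (e i)" 0]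
    by (metis (no_types, lifting) cB e_def cross2_def frame_vec_nth One_nat_def diff_0 diff_zero
        mult.right_neutral mult_zero_left mult_zero_right neg_equal_0_iff_equal one_neq_zero)
  have Ae: "\<Phi> (ideal_point (e i)) = ideal_point (A *v e i)" if "i < 3" for i
    using A(2)[OF that] B[OF e] by simp
  have Anz: "A *v v \<noteq> 0" if "v \<noteq> 0" for v using matrix_vector_nonzero[OF A(1) that] .
  define \<kappa> where "\<kappa> i = \<mu> (e i) * (norm (A *v e i))\<^sup>2" for i
  define d where "d = cmod (det A)"
  have d: "d > 0" using A(1) by (simp add: d_def)
  have \<kappa>pos: "\<kappa> i > 0" for i
    unfolding \<kappa>_def using \<mu>[OF e] Anz[OF e] by simp
  have \<kappa>\<kappa>: "\<kappa> i * \<kappa> j = d\<^sup>2" if "i < 3" "j < 3" "cross2 (e i) (e j) \<noteq> 0" for i j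
    using gram[OF e e Anz[OF e] Anz[OF e] Ae[OF that(1)] Ae[OF that(2)]] that(3)
    unfolding cross2_matrix norm_mult power_mult_distrib \<kappa>_def d_def by simp
  \<comment> \<open>Three pairwise products with the same value determine three positive numbers, so
    every \<open>\<kappa> i\<close> equals \<open>d\<close>.\<close>
  have k: "\<kappa> 0 * \<kappa> 1 = d\<^sup>2" "\<kappa> 0 * \<kappa> 2 = d\<^sup>2" "\<kappa> 1 * \<kappa> 2 = d\<^sup>2"
    by (auto intro!: \<kappa>\<kappa> simp: e_def cross2_def)
  have "\<kappa> 1 = \<kappa> 2" using k(1,2) \<kappa>pos[of 0] by (metis mult_cancel_left less_irrefl)
  moreover have "\<kappa> 0 = \<kappa> 1" using k(2,3) \<kappa>pos[of 2] by (metis mult_cancel_right less_irrefl)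
  ultimately have "\<kappa> 0 = d" "\<kappa> 1 = d" "\<kappa> 2 = d"
    using k \<kappa>pos[of 0] d by (auto simp: power2_eq_square[symmetric] dest!: power2_eq_imp_eq)
  then have \<kappa>: "\<kappa> i = d" if "i < 3" for i
    using that by (metis less_Suc_eq_0_disj numeral_3_eq_3 numeral_2_eq_2 One_nat_def
        not_less0 less_Suc_eq)
  have "\<Phi> (ideal_point a) = ideal_point (A *v a)" if a: "a \<noteq> 0" for a
  proof -
    obtain a' where a': "A *v a' = B a"
      using A(1) by (metis invertible_det_nz invertible_def matrix_vector_mul_assoc
          matrix_vector_mul_lid)
    have a'0: "a' \<noteq> 0" using a' B[OF a] by auto
    have \<Phi>a: "\<Phi> (ideal_point a) = ideal_point (A *v a')" using B[OF a] a' by simp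
    define C where "C = \<mu> a * (norm (B a))\<^sup>2 / d"
    have C: "C > 0" using \<mu>[OF a] B[OF a] d by (simp add: C_def)
    have sq: "(cmod (cross2 a' (e i)))\<^sup>2 = C * (cmod (cross2 a (e i)))\<^sup>2" if "i < 3" for i
    proof -
      have "d\<^sup>2 * (cmod (cross2 a' (e i)))\<^sup>2 =
          \<mu> a * (norm (B a))\<^sup>2 * \<kappa> i * (cmod (cross2 a (e i)))\<^sup>2"
        using gram[OF a e Anz[OF a'0] Anz[OF e] \<Phi>a Ae[OF that]]
          cross2_matrix[of A a' "e i"]
        unfolding a' \<kappa>_def d_def by (simp add: norm_mult power_mult_distrib)
      then show ?thesis
        using d unfolding \<kappa>[OF that] C_def by (simp add: field_simps power2_eq_square)
    qed
    have s0: "(cmod (a' $ 1))\<^sup>2 = C * (cmod (a $ 1))\<^sup>2"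
        and s2: "(cmod (a' $ 2))\<^sup>2 = C * (cmod (a $ 2))\<^sup>2"
      and s1: "(cmod (a' $ 1 - a' $ 2))\<^sup>2 = C * (cmod (a $ 1 - a $ 2))\<^sup>2"
      using sq[of 0] sq[of 1] sq[of 2] by (simp_all add: e_def cross2_def)
    define w w' where "w = a $ 1 * cnj (a $ 2)" and "w' = a' $ 1 * cnj (a' $ 2)"
    have polar: "(cmod (x - y))\<^sup>2 = (cmod x)\<^sup>2 + (cmod y)\<^sup>2 - 2 * Re (x * cnj y)" for x y
      unfolding cmod_power2 by (simp add: power2_eq_square algebra_simps)
    have Re: "Re w' = C * Re w"
      using s1 s0 s2 unfolding polar w_def w'_def by (simp add: algebra_simps)
    \<comment> \<open>Real part and modulus leave only \<open>C * w\<close> and its conjugate for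
      \<open>w'\<close>.\<close>
    have "(cmod w')\<^sup>2 = C\<^sup>2 * (cmod w)\<^sup>2"
      unfolding w_def w'_def norm_mult power_mult_distrib complex_mod_cnj s0 s2
      by (simp add: power2_eq_square)
    then have Im2: "(Im w')\<^sup>2 = (C * Im w)\<^sup>2"
      unfolding cmod_power2 Re by (simp add: power_mult_distrib algebra_simps)
    \<comment> \<open>The quadruples (0, 1, infinity, \<open>a\<close>) and (0, 1, infinity,
      \<open>a'\<close>), whose cross ratios have the imaginary parts of \<open>w\<close> and
      \<open>w'\<close>.\<close>
    define f where "f i = (if i < 3 then e i else a)" for i :: nat
    define f' where "f' i = (if i < 3 then e i else a')" for i :: nat
    have f0: "f i \<noteq> 0" "f' i \<noteq> 0" for i using e a a'0 by (auto simp: f_def f'_def)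
    have cr: "Im (scaled_cross_ratio f) = Im w" "Im (scaled_cross_ratio f') = Im w'"
      by (simp_all add: scaled_cross_ratio_def f_def f'_def e_def cross2_def w_def w'_def
          algebra_simps)
    have \<Phi>f: "\<Phi> (ideal_point (f i)) = ideal_point (A *v f' i)" for i
      using Ae \<Phi>a by (auto simp: f_def f'_def)
    obtain k where k: "k > 0" "orient (ideal_point (A *v f' 0)) (ideal_point (A *v f' 1))
        (ideal_point (A *v f' 2)) (ideal_point (A *v f' 3)) =
        k * orient (ideal_point (f 0)) (ideal_point (f 1)) (ideal_point (f 2)) (ideal_point (f 3))"
      using orient_Isom[OF \<Phi>, of "\<lambda>i. ideal_point (f i)"] norm_ideal_point[OF f0(1)] \<Phi>f by metis
    define N where "N g = (norm (g 0))\<^sup>2 * (norm (g 1))\<^sup>2 * (norm (g 2))\<^sup>2 * (norm (g (3::nat)))\<^sup>2"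
      for g :: "nat \<Rightarrow> complex^2"
    have oN: "N g * orient (ideal_point (g 0)) (ideal_point (g 1)) (ideal_point (g 2))
        (ideal_point (g 3)) = - 8 * Im (scaled_cross_ratio g)"
      if "\<And>i. g i \<noteq> 0" for g
      unfolding N_def by (rule orient_ideal_point) (rule that)
    have N: "N f > 0" "N (\<lambda>i. A *v f' i) > 0"
      using f0 Anz by (auto simp: N_def)
    have "orient (ideal_point (f 0)) (ideal_point (f 1)) (ideal_point (f 2)) (ideal_point (f 3)) =
        (8 / N f) * (- Im w)"
      using oN[of f, OF f0(1)] N cr by (simp add: field_simps)
    moreover have "orient (ideal_point (A *v f' 0)) (ideal_point (A *v f' 1))
        (ideal_point (A *v f' 2)) (ideal_point (A *v f' 3)) =
        (8 * d ^ 4 / N (\<lambda>i. A *v f' i)) * (- Im w')"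
      using oN[of "\<lambda>i. A *v f' i", OF Anz[OF f0(2)]] N cr
      unfolding scaled_cross_ratio_matrix by (simp add: field_simps d_def)
    ultimately have "(8 * d ^ 4 / N (\<lambda>i. A *v f' i)) * Im w' = (k * (8 / N f)) * Im w"
      using k(2) by simp
    moreover have "8 * d ^ 4 / N (\<lambda>i. A *v f' i) > 0" "k * (8 / N f) > 0"
      using N d k by simp_all
    ultimately have sgn: "sgn (Im w') = sgn (Im w)"
      by (metis mult_1 sgn_mult sgn_pos)
    have "\<bar>Im w'\<bar> = C * \<bar>Im w\<bar>"
      using Im2 C by (metis abs_mult abs_of_pos power2_eq_iff abs_minus_cancel)
    then have "Im w' = C * Im w"
      using sgn C by (metis abs_mult_sgn mult.assoc)
    with Re have w: "w' = complex_of_real C * w" by (simp add: complex_eq_iff)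
    have "cross2 a' a = 0"
    proof (cases "a $ 2 = 0")
      case True
      then have "a' $ 2 = 0" using s2 by simp
      with True show ?thesis by (simp add: cross2_def)
    next
      case False
      then have a'2: "a' $ 2 \<noteq> 0" using s2 C by auto
      have n2: "a' $ 2 * cnj (a' $ 2) = complex_of_real C * (a $ 2 * cnj (a $ 2))"
        unfolding complex_norm_square[symmetric] by (simp flip: of_real_power of_real_mult add: s2)
      have "cross2 a' a * (cnj (a' $ 2) * cnj (a $ 2)) =
          w' * (a $ 2 * cnj (a $ 2)) - w * (a' $ 2 * cnj (a' $ 2))"
        by (simp add: cross2_def w_def w'_def algebra_simps)
      also have "\<dots> = 0" unfolding w n2 by simp
      finally show ?thesis using False a'2 by simp
    qed
    then have "ideal_point a' = ideal_point a" using a a'0 by (simp add: ideal_point_eq_iff)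
    then show ?thesis unfolding \<Phi>a by (rule ideal_point_matrix_cong[OF A(1) a'0 a])
  qed
  with A(1) show ?thesis by (rule that)
qed

section \<open>Convergence and uniqueness for maps of the sphere\<close>

lemma tendsto_ideal_point:
  assumes "(f \<longlongrightarrow> a) F" "a \<noteq> 0"
  shows "((\<lambda>n. ideal_point (f n)) \<longlongrightarrow> ideal_point a) F"
proof -
  have c: "((\<lambda>n. f n $ i) \<longlongrightarrow> a $ i) F" for i by (rule tendsto_vec_nth[OF assms(1)])
  have n: "((\<lambda>n. 1 / (norm (f n))\<^sup>2) \<longlongrightarrow> 1 / (norm a)\<^sup>2) F"
    by (intro tendsto_intros assms(1)) (use assms(2) in simp)
  show ?thesis
    unfolding ideal_point_def
  proof (rule tendsto_scaleR[OF n], rule vec_tendstoI)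
    fix i :: 3
    have "i = 1 \<or> i = 2 \<or> i = 3" by (rule exhaust_3)
    then show "((\<lambda>n. vector [2 * Re (f n $ 1 * cnj (f n $ 2)), 2 * Im (f n $ 1 * cnj (f n $ 2)),
        (cmod (f n $ 1))\<^sup>2 - (cmod (f n $ 2))\<^sup>2] $ i) \<longlongrightarrow>
      vector [2 * Re (a $ 1 * cnj (a $ 2)), 2 * Im (a $ 1 * cnj (a $ 2)),
        (cmod (a $ 1))\<^sup>2 - (cmod (a $ 2))\<^sup>2] $ i) F"
      by (elim disjE; simp only: vector_3) (intro tendsto_intros c)+
  qed
qed

text \<open>Two projective maps of the line that agree at three points coincide: \<open>v \<mapsto> cross2 (P v) (Q v)\<close>
  is a quadratic form.\<close>

lemma ideal_point_matrix_eqI: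
  fixes P Q :: "complex^2^2"
  assumes "det P \<noteq> 0" "det Q \<noteq> 0"
    and ind: "cross2 u v \<noteq> 0" "cross2 u w \<noteq> 0" "cross2 v w \<noteq> 0"
    and eq: "ideal_point (P *v u) = ideal_point (Q *v u)" "ideal_point (P *v v) =
        ideal_point (Q *v v)" "ideal_point (P *v w) = ideal_point (Q *v w)"
    and a: "a \<noteq> 0"
  shows "ideal_point (P *v a) = ideal_point (Q *v a)"
proof -
  define B where "B x y = cross2 (P *v x) (Q *v y)" for x y
  have lin: "B (s *s x + t *s y) z = s * B x z + t * B y z" "B z (s *s x + t *s y) =
      s * B z x + t * B z y" for s t x y z
    by (simp_all add: B_def cross2_def matrix_vector_2 algebra_simps)
  have nz: "u \<noteq> 0" "v \<noteq> 0" "w \<noteq> 0" using ind by (auto simp: cross2_def)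
  have B0: "B u u = 0" "B v v = 0" "B w w = 0"
    using eq nz assms(1,2) by (simp_all add: B_def ideal_point_eq_iff matrix_vector_nonzero)
  have expand: "x = (cross2 x v / cross2 u v) *s u + (cross2 u x / cross2 u v) *s v" for x
    using ind(1) by (simp add: vec2_eq_iff field_simps) (simp add: cross2_def algebra_simps)
  define s t where "s = cross2 w v / cross2 u v" and "t = cross2 u w / cross2 u v"
  have "cross2 w v = - cross2 v w" by (simp add: cross2_def)
  then have st: "s \<noteq> 0" "t \<noteq> 0" using ind by (auto simp: s_def t_def)
  have quad: "B (s *s u + t *s v) (s *s u + t *s v) = s * t * (B u v + B v u)" for s t
    unfolding lin B0 by (simp add: algebra_simps)
  have "w = s *s u + t *s v" unfolding s_def t_def by (rule expand)
  then have "s * t * (B u v + B v u) = 0"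
    using quad B0(3) by metis
  then have polar: "B u v + B v u = 0" using st by simp
  define s' t' where "s' = cross2 a v / cross2 u v" and "t' = cross2 u a / cross2 u v"
  have "a = s' *s u + t' *s v" unfolding s'_def t'_def by (rule expand)
  then have "B a a = s' * t' * (B u v + B v u)"
    using quad by metis
  then have "B a a = 0" using polar by simp
  then show ?thesis
    using a assms(1,2) by (simp add: B_def ideal_point_eq_iff matrix_vector_nonzero)
qed

lemma cross2_frame_vec:
  assumes "z \<noteq> 0" "z \<noteq> 1" "i < 4" "j < 4" "i \<noteq> j"
  shows "cross2 (frame_vec z i) (frame_vec z j) \<noteq> 0"
proof -
  have "i = 0 \<or> i = 1 \<or> i = 2 \<or> i = 3" "j = 0 \<or> j = 1 \<or> j = 2 \<or> j = 3" using assms by auto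
  then show ?thesis using assms by (elim disjE) (simp_all add: cross2_def)
qed

lemma has_modulus_frame:
  assumes "has_modulus (v 0) (v 1) (v 2) (v 3) z"
  obtains B :: "complex^2^2" where "det B \<noteq> 0" "\<And>i. i < 4 \<Longrightarrow> v i = ideal_point (B *v frame_vec z i)"
proof -
  obtain \<Phi> where \<Phi>: "\<Phi> \<in> Isom_plus" "\<Phi> (v 0) = bd_point 0" "\<Phi> (v 1) = bd_point 1"
      "\<Phi> (v 2) = bd_infinity" "\<Phi> (v 3) = bd_point z"
    and sph: "{v 0, v 1, v 2, v 3} \<subseteq> sphere 0 1"
    using assms unfolding has_modulus_def by auto
  obtain A :: "complex^2^2" where A: "det A \<noteq> 0" "\<And>a. a \<noteq> 0 \<Longrightarrow> \<Phi> (ideal_point a) =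
      ideal_point (A *v a)"
    using Isom_plus_Moebius[OF \<Phi>(1)] by metis
  obtain B where B: "A ** B = mat 1" "B ** A = mat 1"
    using A(1) by (metis invertible_det_nz invertible_def)
  have dB: "det B \<noteq> 0" using B by (metis det_I det_mul mult_zero_right zero_neq_one)
  have "v i = ideal_point (B *v frame_vec z i)" if "i < 4" for i
  proof -
    have i: "i = 0 \<or> i = 1 \<or> i = 2 \<or> i = 3" using that by auto
    then have "norm (v i) = 1" using sph by auto
    then obtain a where a: "a \<noteq> 0" "ideal_point a = v i" by (rule ideal_point_surj)
    have "\<Phi> (v i) = ideal_point (frame_vec z i)"
      using i \<Phi> by (auto simp: bd_point_eq_ideal_point bd_infinity_eq_ideal_point frame_vec_def)
    then have "ideal_point (A *v a) = ideal_point (frame_vec z i)" using A(2)[OF a(1)] a(2) by simp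
    from ideal_point_matrix_cong[OF dB matrix_vector_nonzero[OF A(1) a(1)] frame_vec_nonzero this]
    show ?thesis by (simp add: matrix_vector_mul_assoc B a)
  qed
  with dB show ?thesis by (rule that)
qed

text \<open>The origin lies on the geodesic from \<open>u\<close> to \<open>-u\<close>, and
  \<open>eq\<close> says that its image lies on the geodesic between the images of these ends. In
  the limit \<open>y\<close> lies on the diameter through \<open>u\<close>.\<close>

lemma Isom_axis_limit:
  assumes \<Phi>: "\<And>n::nat. \<Phi> n \<in> Isom_plus"
    and lim: "\<And>u. norm u = 1 \<Longrightarrow> (\<lambda>n. \<Phi> n u) \<longlonglongrightarrow> u"
    and y: "(\<lambda>n. \<Phi> n 0) \<longlonglongrightarrow> y" and u: "norm u = 1"
  shows "y \<bullet> y = (y \<bullet> u)\<^sup>2"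
proof -
  have u': "norm (- u) = 1" using u by simp
  have eq: "(1 - \<Phi> n 0 \<bullet> \<Phi> n u) * (1 - \<Phi> n 0 \<bullet> \<Phi> n (- u)) =
      (1 - \<Phi> n 0 \<bullet> \<Phi> n 0) * ((1 - \<Phi> n u \<bullet> \<Phi> n (- u)) / 2)" for n
  proof -
    have 0: "(0::real^3) \<in> H3" by simp
    have h: "klein_scale (\<Phi> n 0) > 0" "(klein_scale (\<Phi> n 0))\<^sup>2 = 1 - \<Phi> n 0 \<bullet> \<Phi> n 0"
      using klein_scale_pos[OF Isom_plusD(2)[OF \<Phi> 0]]
          by (auto simp: klein_scale_def intro: less_imp_le)
    have "1 - \<Phi> n 0 \<bullet> \<Phi> n v = klein_scale (\<Phi> n 0) * boundary_factor (\<Phi> n) v" for v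
      using h by (simp add: boundary_factor_def)
    moreover have "1 - \<Phi> n u \<bullet> \<Phi> n (- u) = boundary_factor (\<Phi> n) u * boundary_factor
        (\<Phi> n) (- u) * 2"
      using Isom_boundary[OF \<Phi> u' u] u by (simp add: dot_square_norm)
    ultimately show ?thesis unfolding h(2)[symmetric] by (simp add: power2_eq_square)
  qed
  have a: "(\<lambda>n. (1 - \<Phi> n 0 \<bullet> \<Phi> n u) * (1 - \<Phi> n 0 \<bullet> \<Phi> n (- u))) \<longlonglongrightarrow> (1 - y \<bullet> u) * (1 - y \<bullet> (- u))"
    by (intro tendsto_intros y lim u u')
  have b: "(\<lambda>n. (1 - \<Phi> n 0 \<bullet> \<Phi> n 0) * ((1 - \<Phi> n u \<bullet> \<Phi> n (- u)) / 2)) \<longlonglongrightarrow>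
      (1 - y \<bullet> y) * ((1 - u \<bullet> (- u)) / 2)"
    by (intro tendsto_intros y lim u u') simp
  show ?thesis
    using LIMSEQ_unique[OF a b[folded eq]] u
        by (simp add: dot_square_norm power2_eq_square algebra_simps)
qed

text \<open>Compactness of the closed ball gives a limit point, which could still be at infinity;
  lying on two different diameters forces it to be the centre.\<close>

lemma Isom_tendsto_id_subseq:
  assumes \<Phi>: "\<And>n::nat. \<Phi> n \<in> Isom_plus"
    and lim: "\<And>u. norm u = 1 \<Longrightarrow> (\<lambda>n. \<Phi> n u) \<longlonglongrightarrow> u"
  obtains r :: "nat \<Rightarrow> nat" where "strict_mono r" "(\<lambda>n. \<Phi> (r n) 0) \<longlonglongrightarrow> 0"
proof -
  have "\<Phi> n 0 \<in> cball 0 1" for n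
    using Isom_plusD(2)[OF \<Phi>, of 0 n] by (simp add: less_imp_le)
  then obtain y r where r: "strict_mono (r::nat \<Rightarrow> nat)" "((\<lambda>n. \<Phi> n 0) \<circ> r) \<longlonglongrightarrow> y"
    using compact_cball[of "0::real^3" 1] unfolding compact_def by metis
  then have y: "(\<lambda>n. \<Phi> (r n) 0) \<longlonglongrightarrow> y" by (simp add: o_def)
  have lim': "(\<lambda>n. \<Phi> (r n) u) \<longlonglongrightarrow> u" if "norm u = 1" for u
    using LIMSEQ_subseq_LIMSEQ[OF lim[OF that] r(1)] by (simp add: o_def)
  have *: "y \<bullet> y = (y $ k)\<^sup>2" for k
    using Isom_axis_limit[OF \<Phi> lim' y, of "axis k 1"] by (simp add: inner_axis)
  have "y $ 1 = 0 \<and> y $ 2 = 0 \<and> y $ 3 = 0"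
    using *[of 1] *[of 3] unfolding inner_vec3
    by (simp add: power2_eq_square[symmetric] sum_power2_eq_zero_iff)
  then have "y = 0" by (simp add: vec3_eq_iff)
  with r(1) y show ?thesis using that by blast
qed

section \<open>Simplices in barycentric coordinates\<close>

lemma subsimplex_eq:
  "subsimplex F = {s. (\<forall>a. 0 \<le> s $ a) \<and> (\<forall>a. a \<notin> F \<longrightarrow> s $ a = 0) \<and> (\<Sum>a\<in>UNIV. s $ a) =
      1}" (is "_ = ?R")
proof
  have "convex ?R"
    by (rule convexI) (auto simp: sum.distrib sum_distrib_left[symmetric])
  moreover have "axis a 1 \<in> ?R" if "a \<in> F" for a
    using that by (auto simp: axis_def)
  ultimately show "subsimplex F \<subseteq> ?R"
    unfolding subsimplex_def by (intro hull_minimal) auto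
next
  show "?R \<subseteq> subsimplex F"
  proof
    fix s assume s: "s \<in> ?R"
    have "s = (\<Sum>a\<in>UNIV. s $ a *\<^sub>R axis a 1)"
      by (simp add: vec_eq_iff axis_def if_distrib cong: if_cong)
    also have "\<dots> = (\<Sum>a\<in>F. s $ a *\<^sub>R axis a 1)"
      using s by (intro sum.mono_neutral_right) auto
    also have "\<dots> \<in> subsimplex F"
      unfolding subsimplex_def
    proof (rule convex_sum)
      have "(\<Sum>a\<in>F. s $ a) = (\<Sum>a\<in>UNIV. s $ a)"
        using s by (intro sum.mono_neutral_left) auto
      then show "(\<Sum>a\<in>F. s $ a) = 1" using s by simp
      show "axis a 1 \<in> convex hull (\<lambda>a. axis a 1) ` F" if "a \<in> F" for a
        using that by (intro hull_inc) auto
    qed (use s in auto)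
    finally show "s \<in> subsimplex F" .
  qed
qed

text \<open>This form exhibits the tetrahedron without its vertices as convex, hence connected and
  simply connected, as needed for lifting through \<open>q\<close>.\<close>

lemma ideal_tetra_eq: "ideal_tetra X = tetra X \<inter> {s. \<forall>a. s $ a < 1}"
proof -
  have "s \<in> (\<lambda>a. axis a 1) ` set (verts X) \<longleftrightarrow> \<not> (\<forall>a. s $ a < 1)" if s: "s \<in> tetra X" for s
  proof
    assume "s \<in> (\<lambda>a. axis a 1) ` set (verts X)"
    then obtain a where "s = axis a 1" by auto
    then have "s $ a = 1" by simp
    then show "\<not> (\<forall>a. s $ a < 1)" by (metis less_irrefl)
  next
    assume "\<not> (\<forall>a. s $ a < 1)"
    then obtain a where a: "1 \<le> s $ a" by (auto simp: not_less)
    have s': "\<And>b. 0 \<le> s $ b" "\<And>b. b \<notin> set (verts X) \<Longrightarrow> s $ b = 0" "(\<Sum>b\<in>UNIV. s $ b) = 1"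
      using s unfolding tetra_def subsimplex_eq by auto
    have sum: "s $ a + (\<Sum>b\<in>UNIV - {a}. s $ b) = 1"
      using s'(3) sum.remove[of UNIV a "($) s"] by simp
    moreover have "(\<Sum>b\<in>UNIV - {a}. s $ b) \<ge> 0" by (intro sum_nonneg s')
    ultimately have "(\<Sum>b\<in>UNIV - {a}. s $ b) = 0" "s $ a = 1" using a by auto
    then have "s $ b = (if b = a then 1 else 0)" for b
      using s'(1) by (subst (asm) sum_nonneg_eq_0_iff) auto
    then have "s = axis a 1" by (simp add: vec_eq_iff axis_def)
    moreover have "a \<in> set (verts X)" using s'(2)[of a] a by fastforce
    ultimately show "s \<in> (\<lambda>a. axis a 1) ` set (verts X)" by blast
  qed
  then show ?thesis unfolding ideal_tetra_def by auto
qed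

lemma convex_subsimplex: "convex (subsimplex F)"
  by (simp add: subsimplex_def convex_convex_hull)

lemma convex_ideal_tetra: "convex (ideal_tetra X)"
proof -
  have "{s::real^vlabel. \<forall>a. s $ a < 1} = (\<Inter>a. {s. inner (axis a 1) s < 1})"
    by (auto simp: inner_axis')
  then have "convex {s::real^vlabel. \<forall>a. s $ a < 1}"
    by (simp only:) (intro convex_INT convex_halfspace_lt)
  then show ?thesis
    unfolding ideal_tetra_eq tetra_def by (intro convex_Int convex_subsimplex)
qed

lemma ideal_tetra_subset: "ideal_tetra X \<subseteq> tetra X"
  by (auto simp: ideal_tetra_def)

lemma subsimplex_mono: "F \<subseteq> G \<Longrightarrow> subsimplex F \<subseteq> subsimplex G"
  by (auto simp: subsimplex_eq)

lemma axis_in_tetra: "a \<in> set (verts X) \<Longrightarrow> axis a 1 \<in> tetra X"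
  unfolding tetra_def subsimplex_def by (intro hull_inc) auto

definition barycenter :: "vlabel set \<Rightarrow> real^vlabel"
  where "barycenter F = (\<chi> a. if a \<in> F then 1 / card F else 0)"

lemma barycenter_in:
  assumes "2 \<le> card F" "F \<subseteq> set (verts X)"
  shows "barycenter F \<in> subsimplex F" "barycenter F \<in> ideal_tetra X"
proof -
  show "barycenter F \<in> subsimplex F"
    using assms by (auto simp: subsimplex_eq barycenter_def sum.If_cases)
  then show "barycenter F \<in> ideal_tetra X"
    unfolding ideal_tetra_eq tetra_def using subsimplex_mono[OF assms(2)] assms(1)
    by (auto simp: barycenter_def)
qed

lemma ideal_tetra_nonempty: "ideal_tetra X \<noteq> {}"
proof -
  have "card (set (verts X)) = 4" by (cases X) auto
  then have "barycenter (set (verts X)) \<in> ideal_tetra X"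
    by (intro barycenter_in) auto
  then show ?thesis by blast
qed

text \<open>Lifts are defined only away from the vertices, so ideal vertices are reached as limits.
  Staying in the face \<open>F\<close> lets two tetrahedra glued along it be compared there.\<close>

lemma vertex_sequence:
  assumes F: "2 \<le> card F" "F \<subseteq> set (verts X)" and a: "a \<in> F"
  obtains s where "\<And>n::nat. s n \<in> ideal_tetra X \<inter> subsimplex F" "s \<longlonglongrightarrow> axis a 1"
proof
  define e where "e n = inverse (real (Suc n))" for n
  have e: "0 < e n" "e n \<le> 1" for n by (auto simp: e_def inverse_eq_divide)
  show "(1 - e n) *\<^sub>R axis a 1 + e n *\<^sub>R barycenter F \<in> ideal_tetra X \<inter> subsimplex F" for n
  proof -
    let ?s = "(1 - e n) *\<^sub>R axis a 1 + e n *\<^sub>R barycenter F"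
    have "axis a 1 \<in> subsimplex F"
      unfolding subsimplex_def using a by (intro hull_inc) auto
    then have s: "?s \<in> subsimplex F"
      using e[of n] barycenter_in(1)[OF F] by (intro convexD[OF convex_subsimplex]) auto
    have c: "1 / real (card F) < 1" using F by simp
    have "?s $ b < 1" for b
    proof (cases "b = a")
      case True
      have "e n * (1 / real (card F)) < e n * 1" using c e by (intro mult_strict_left_mono) auto
      then show ?thesis using True a by (simp add: barycenter_def)
    next
      case False
      have "e n * (1 / real (card F)) < e n * 1" using c e by (intro mult_strict_left_mono) auto
      then show ?thesis using False e[of n] by (auto simp: barycenter_def axis_def)
    qed
    with s show ?thesis using subsimplex_mono[OF F(2)] unfolding ideal_tetra_eq tetra_def by auto
  qed
  have "(\<lambda>n. (1 - e n) *\<^sub>R axis a 1 + e n *\<^sub>R barycenter F) \<longlonglongrightarrow>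
      (1 - 0) *\<^sub>R axis a 1 + 0 *\<^sub>R barycenter F"
    unfolding e_def by (intro tendsto_intros LIMSEQ_inverse_real_of_nat)
  then show "(\<lambda>n. (1 - e n) *\<^sub>R axis a 1 + e n *\<^sub>R barycenter F) \<longlonglongrightarrow> axis a 1" by simp
qed

definition face_map :: "vlabel list \<Rightarrow> vlabel list \<Rightarrow> real^vlabel \<Rightarrow> real^vlabel"
  where "face_map F G s = (\<Sum>i<length F. s $ (F ! i) *\<^sub>R axis (G ! i) 1)"

lemma face_map_nth:
  assumes "distinct G" "length G = length F" "i < length F"
  shows "face_map F G s $ (G ! i) = s $ (F ! i)"
proof -
  have "face_map F G s $ (G ! i) = (\<Sum>j<length F. if j = i then s $ (F ! j) else 0)"
    unfolding face_map_def sum_component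
    using assms by (intro sum.cong) (auto simp: axis_def nth_eq_iff_index_eq)
  then show ?thesis using assms(3) by simp
qed

lemma face_map_notin: "length G = length F \<Longrightarrow> b \<notin> set G \<Longrightarrow> face_map F G s $ b = 0"
  unfolding face_map_def sum_component by (intro sum.neutral) (auto simp: axis_def)

lemma face_map_axis:
  assumes "distinct F" "length G = length F" "i < length F"
  shows "face_map F G (axis (F ! i) 1) = axis (G ! i) 1"
proof -
  have "face_map F G (axis (F ! i) 1) = (\<Sum>j<length F. if j = i then axis (G ! j) 1 else 0)"
    unfolding face_map_def
    using assms by (intro sum.cong) (auto simp: axis_def nth_eq_iff_index_eq)
  then show ?thesis using assms(3) by simp
qed

lemma continuous_on_face_map: "continuous_on S (face_map F G)"
  unfolding face_map_def by (intro continuous_intros)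

lemma face_map_face:
  assumes d: "distinct F" "distinct G" "length G = length F" and G: "set G \<subseteq> set (verts Y)"
    and s: "s \<in> ideal_tetra X \<inter> subsimplex (set F)"
  shows "face_map F G s \<in> ideal_tetra Y \<inter> subsimplex (set G)"
    "map (($) s) F = map (($) (face_map F G s)) G"
proof -
  show "map (($) s) F = map (($) (face_map F G s)) G"
    using d by (auto simp: list_eq_iff_nth_eq face_map_nth)
  have s': "\<And>a. 0 \<le> s $ a" "\<And>a. a \<notin> set F \<Longrightarrow> s $ a = 0" "(\<Sum>a\<in>UNIV. s $ a) = 1" "\<And>a. s $ a < 1"
    using s unfolding subsimplex_eq ideal_tetra_eq by auto
  have r: "0 \<le> face_map F G s $ b \<and> face_map F G s $ b < 1" for b
  proof (cases "b \<in> set G")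
    case True
    then obtain i where "i < length F" "b = G ! i" using d by (auto simp: in_set_conv_nth)
    then show ?thesis using s' d by (simp add: face_map_nth)
  qed (simp add: face_map_notin d)
  have "(\<Sum>b\<in>UNIV. face_map F G s $ b) = (\<Sum>b\<in>set G. face_map F G s $ b)"
    by (intro sum.mono_neutral_right) (auto simp: face_map_notin d)
  also have "\<dots> = (\<Sum>i<length F. face_map F G s $ (G ! i))"
    using bij_betw_nth[of G "{..<length F}"] d by (simp add: sum.reindex_bij_betw[of "(!) G"
        "{..<length F}" "set G", symmetric])
  also have "\<dots> = (\<Sum>i<length F. s $ (F ! i))"
    using d by (simp add: face_map_nth)
  also have "\<dots> = (\<Sum>a\<in>set F. s $ a)"
    using bij_betw_nth[of F "{..<length F}"] d by (simp add: sum.reindex_bij_betw[of "(!) F"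
        "{..<length F}" "set F", symmetric])
  also have "\<dots> = 1"
    using s'(3) sum.mono_neutral_left[of UNIV "set F" "($) s"] s'(2) by auto
  finally have "face_map F G s \<in> subsimplex (set G)"
    using r d by (auto simp: subsimplex_eq face_map_notin)
  then show "face_map F G s \<in> ideal_tetra Y \<inter> subsimplex (set G)"
    using subsimplex_mono[OF G] r by (auto simp: ideal_tetra_eq tetra_def)
qed

section \<open>Developing along the faces\<close>

text \<open>\<open>takeWhile\<close> counts the labels in front of \<open>a\<close>, which gives its
  position in \<open>verts X\<close>.\<close>

definition vertex_vec :: "(tet \<Rightarrow> complex) \<Rightarrow> tet \<Rightarrow> vlabel \<Rightarrow> complex^2"
  where "vertex_vec z X a = frame_vec (z X) (length (takeWhile (\<lambda>b. b \<noteq> a) (verts X)))"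

lemma vertex_vec_nonzero [simp]: "vertex_vec z X a \<noteq> 0"
  by (simp add: vertex_vec_def)

lemma vertex_vec_simps [simp]:
  "vertex_vec z TA V0 = vector [0, 1]" "vertex_vec z TA V01 = vector [1, 1]"
  "vertex_vec z TA V11 = vector [1, 0]" "vertex_vec z TA V10 = vector [z TA, 1]"
  "vertex_vec z TB V0 = vector [0, 1]" "vertex_vec z TB V10 = vector [1, 1]"
  "vertex_vec z TB V11 = vector [1, 0]" "vertex_vec z TB V21 = vector [z TB, 1]"
  "vertex_vec z TC V0 = vector [0, 1]" "vertex_vec z TC V21 = vector [1, 1]"
  "vertex_vec z TC V11 = vector [1, 0]" "vertex_vec z TC V32 = vector [z TC, 1]"
  "vertex_vec z TD V0 = vector [0, 1]" "vertex_vec z TD V32 = vector [1, 1]"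
  "vertex_vec z TD V11 = vector [1, 0]" "vertex_vec z TD V43 = vector [z TD, 1]"
  by (simp_all add: vertex_vec_def frame_vec_def)

lemma cross2_vertex_vec:
  assumes "z X \<noteq> 0" "z X \<noteq> 1" "a \<in> set (verts X)" "b \<in> set (verts X)" "a \<noteq> b"
  shows "cross2 (vertex_vec z X a) (vertex_vec z X b) \<noteq> 0"
proof -
  have "length (takeWhile (\<lambda>c. c \<noteq> a) (verts X)) < 4 \<and>
      length (takeWhile (\<lambda>c. c \<noteq> b) (verts X)) < 4 \<and>
     length (takeWhile (\<lambda>c. c \<noteq> a) (verts X)) \<noteq> length (takeWhile (\<lambda>c. c \<noteq> b) (verts X))"
    using assms(3-5) by (cases X) auto
  then show ?thesis
    unfolding vertex_vec_def using cross2_frame_vec[OF assms(1,2)] by blast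
qed

text \<open>\<open>k X\<close> stands for \<open>f \<circ> \<phi> X\<close>; a lift of it through \<open>q\<close> differs from the developed one by a deck
  transformation, hence also extends continuously to the ideal vertices.\<close>

locale development =
  fixes M :: "'m::real_normed_vector set" and q :: "real^3 \<Rightarrow> 'm"
    and k :: "tet \<Rightarrow> real^vlabel \<Rightarrow> 'm" and z :: "tet \<Rightarrow> complex"
  assumes hyp: "complete_hyperbolic_structure M q"
    and k_cont: "continuous_on (ideal_tetra X) (k X)"
    and k_in: "k X \<in> ideal_tetra X \<rightarrow> M"
    and k_glued: "glued (X, s) (Y, t) \<Longrightarrow> k X s = k Y t"
    and z: "z X \<noteq> 0" "z X \<noteq> 1"
    and developed: "\<exists>g. compatible_map X (z X) g \<and> is_lift H3 q (ideal_tetra X) (k X) g"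
begin

definition framed :: "tet \<Rightarrow> complex^2^2 \<Rightarrow> (real^vlabel \<Rightarrow> real^3) \<Rightarrow> bool"
  where "framed X B g \<longleftrightarrow> det B \<noteq> 0 \<and> is_lift H3 q (ideal_tetra X) (k X) g \<and>
    continuous_on (tetra X) g \<and> g \<in> tetra X \<rightarrow> cball 0 1 \<and>
    (\<forall>a\<in>set (verts X). g (axis a 1) = ideal_point (B *v vertex_vec z X a))"

text \<open>All positions of developed copies of \<open>X\<close>. Relative to one frame
  \<open>B\<close>, the matrices \<open>E\<close> for which \<open>B ** E\<close> is again a frame
  describe the deck group in the coordinates of \<open>B\<close>.\<close>

definition frames :: "tet \<Rightarrow> (complex^2^2) set"
  where "frames X = {B. \<exists>g. framed X B g}"

lemma covering: "covering_space H3 q M"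
  using hyp by (simp add: complete_hyperbolic_structure_def)

lemma frames_nonempty: obtains B where "B \<in> frames X"
proof -
  obtain g where g: "compatible_map X (z X) g" "is_lift H3 q (ideal_tetra X) (k X) g"
    using developed by blast
  define v where "v i = g (axis (verts X ! i) 1)" for i
  have g': "continuous_on (tetra X) g" "has_modulus (v 0) (v 1) (v 2) (v 3) (z X)"
    "g ` tetra X = convex hull ((\<lambda>a. g (axis a 1)) ` set (verts X))"
    using g(1) by (auto simp: compatible_map_def Let_def v_def)
  obtain B where B: "det B \<noteq> 0" "\<And>i. i < 4 \<Longrightarrow> v i = ideal_point (B *v frame_vec (z X) i)"
    using has_modulus_frame[OF g'(2)] by metis
  have vert: "g (axis a 1) = ideal_point (B *v vertex_vec z X a)" if "a \<in> set (verts X)" for a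
  proof -
    let ?i = "length (takeWhile (\<lambda>b. b \<noteq> a) (verts X))"
    have "?i < 4 \<and> verts X ! ?i = a"
      using that by (cases X) auto
    then show ?thesis
      using B(2)[of ?i] by (simp add: v_def vertex_vec_def)
  qed
  have "(\<lambda>a. g (axis a 1)) ` set (verts X) \<subseteq> cball 0 1"
    using vert matrix_vector_nonzero[OF B(1)] by (auto simp: norm_ideal_point)
  then have "g ` tetra X \<subseteq> cball 0 1"
    unfolding g'(3) by (intro hull_minimal convex_cball)
  then have "framed X B g"
    unfolding framed_def using B(1) g(2) g'(1) vert by auto
  then show ?thesis using that by (auto simp: frames_def)
qed

lemma lift_unique:
  assumes "is_lift H3 q S j h1" "is_lift H3 q S j h2" "connected S" "continuous_on S j"
    "a \<in> S" "h1 a = h2 a" "x \<in> S"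
  shows "h1 x = h2 x"
proof (rule covering_space_lift_unique[where ?g1.0 = h1 and ?g2.0 = h2 and a = a and T = S and f =
    j, OF covering])
  show "j \<in> S \<rightarrow> M"
  proof
    fix x assume "x \<in> S"
    then have "j x = q (h1 x)" "h1 x \<in> H3" using assms(1) by (auto simp: is_lift_def)
    then show "j x \<in> M" using covering_space_imp_surjective[OF covering] by blast
  qed
qed (use assms in \<open>auto simp: is_lift_def\<close>)

definition deck :: "(real^3 \<Rightarrow> real^3) \<Rightarrow> bool"
  where "deck \<Phi> \<longleftrightarrow> \<Phi> \<in> Isom_plus \<and> (\<forall>w\<in>H3. q (\<Phi> w) = q w)"

lemma deck_lift:
  assumes "deck \<Phi>" "is_lift H3 q S j h"
  shows "is_lift H3 q S j (\<Phi> \<circ> h)"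
proof -
  have c: "continuous_on H3 \<Phi>"
    using assms(1) Isom_plusD(1)[of \<Phi>] by (auto simp: deck_def intro: continuous_on_subset)
  have "continuous_on S (\<Phi> \<circ> h)"
    using assms(2) by (intro continuous_on_compose continuous_on_subset[OF c])
        (auto simp: is_lift_def)
  then show ?thesis
    using assms Isom_plusD(2)[of \<Phi>] by (auto simp: is_lift_def deck_def Pi_iff)
qed

text \<open>Deck transformations are transitive on fibres, so one matches the lifts at a single
  point; uniqueness of lifts extends the match to the connected set \<open>S\<close>.\<close>

lemma deck_between:
  assumes h: "is_lift H3 q S j h1" "is_lift H3 q S j h2"
      and S: "connected S" "S \<noteq> {}" "continuous_on S j"
  obtains \<Phi> where "deck \<Phi>" "\<And>s. s \<in> S \<Longrightarrow> h2 s = \<Phi> (h1 s)"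
proof -
  obtain a where a: "a \<in> S" using S by blast
  have "h1 a \<in> H3" "h2 a \<in> H3" "q (h1 a) = q (h2 a)"
    using h a by (auto simp: is_lift_def)
  then obtain \<Phi> where \<Phi>: "deck \<Phi>" "\<Phi> (h1 a) = h2 a"
    using hyp unfolding complete_hyperbolic_structure_def deck_def by metis
  show ?thesis
  proof (rule that[OF \<Phi>(1)])
    fix s assume "s \<in> S"
    then show "h2 s = \<Phi> (h1 s)"
      using lift_unique[OF deck_lift[OF \<Phi>(1) h(1)] h(2) S(1,3) a] \<Phi>(2) by simp
  qed
qed

lemma tetra_limit:
  assumes "a \<in> set (verts X)"
  obtains s where "\<And>n::nat. s n \<in> ideal_tetra X" "s \<longlonglongrightarrow> axis a 1"
    "\<And>g. continuous_on (tetra X) g \<Longrightarrow> (\<lambda>n. g (s n) :: real^3) \<longlonglongrightarrow> g (axis a 1)"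
proof -
  have "2 \<le> card (set (verts X))" by (cases X) auto
  from vertex_sequence[OF this subset_refl assms]
  obtain s where s: "\<And>n::nat. s n \<in> ideal_tetra X" "s \<longlonglongrightarrow> axis a 1"
    by (metis IntD1)
  moreover have "(\<lambda>n. g (s n)) \<longlonglongrightarrow> g (axis a 1)" if "continuous_on (tetra X) g" for g :: "_ \<Rightarrow> real^3"
    by (rule continuous_on_tendsto_compose[OF that s(2)])
       (use s(1) ideal_tetra_subset axis_in_tetra[OF assms] in \<open>auto intro: always_eventually\<close>)
  ultimately show ?thesis using that by blast
qed

lemma framed_deck:
  assumes "framed X B g" "deck \<Phi>" "det B' \<noteq> 0"
    "\<And>a. a \<in> set (verts X) \<Longrightarrow> \<Phi> (ideal_point (B *v vertex_vec z X a)) =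
        ideal_point (B' *v vertex_vec z X a)"
  shows "framed X B' (\<Phi> \<circ> g)"
proof -
  have \<Phi>: "\<Phi> \<in> Isom_plus" using assms(2) by (simp add: deck_def)
  have g: "continuous_on (tetra X) g" "g \<in> tetra X \<rightarrow> cball 0 1"
      "is_lift H3 q (ideal_tetra X) (k X) g"
    using assms(1) by (auto simp: framed_def)
  have "continuous_on (tetra X) (\<Phi> \<circ> g)"
    using g by (intro continuous_on_compose continuous_on_subset[OF Isom_plusD(1)[OF \<Phi>]]) auto
  moreover have "\<Phi> x \<in> cball 0 1" if "x \<in> cball 0 1" for x
    using that Isom_cball[OF \<Phi>, of x] Isom_plusD(2)[OF \<Phi>, of x] by (cases "norm x = 1") auto
  ultimately show ?thesis
    using assms(1,3,4) deck_lift[OF assms(2) g(3)] by (auto simp: framed_def Pi_iff)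
qed

text \<open>Only one lift is known to be compatible with the modulus. Any other is its image under a
  deck transformation, which acts on the ideal vertices by a matrix.\<close>

lemma framed_lift:
  assumes "is_lift H3 q (ideal_tetra X) (k X) h"
  obtains B g where "framed X B g" "\<And>s. s \<in> ideal_tetra X \<Longrightarrow> g s = h s"
proof -
  obtain B where "B \<in> frames X" by (rule frames_nonempty)
  then obtain g where g: "framed X B g" by (auto simp: frames_def)
  then have "is_lift H3 q (ideal_tetra X) (k X) g" by (simp add: framed_def)
  from deck_between[OF this assms convex_connected[OF convex_ideal_tetra]
      ideal_tetra_nonempty k_cont]
  obtain \<Phi> where \<Phi>: "deck \<Phi>" "\<And>s. s \<in> ideal_tetra X \<Longrightarrow> h s = \<Phi> (g s)" by metis
  then obtain A :: "complex^2^2" where A: "det A \<noteq> 0" "\<And>a. a \<noteq> 0 \<Longrightarrow> \<Phi> (ideal_point a) =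
      ideal_point (A *v a)"
    using Isom_plus_Moebius[of \<Phi>] by (auto simp: deck_def)
  have dB: "det B \<noteq> 0" using g by (simp add: framed_def)
  have "framed X (A ** B) (\<Phi> \<circ> g)"
    by (rule framed_deck[OF g \<Phi>(1)])
       (use A dB matrix_vector_nonzero[OF dB] in \<open>auto simp: det_mul matrix_vector_mul_assoc\<close>)
  then show ?thesis using that \<Phi>(2) by (metis comp_apply)
qed

lemma frames_eqI:
  assumes "B \<in> frames X" "det B' \<noteq> 0"
    "\<And>a. a \<in> set (verts X) \<Longrightarrow> ideal_point (B' *v vertex_vec z X a) =
        ideal_point (B *v vertex_vec z X a)"
  shows "B' \<in> frames X"
  using assms unfolding frames_def framed_def by auto

text \<open>The match of the two lifts passes to the ideal vertices by continuity, and three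
  vertices determine a Moebius map.\<close>

lemma frames_deck:
  assumes "B \<in> frames X" "B' \<in> frames X"
  obtains \<Phi> where "deck \<Phi>" "\<And>a. a \<noteq> 0 \<Longrightarrow> \<Phi> (ideal_point (B *v a)) = ideal_point (B' *v a)"
proof -
  obtain g g' where g: "framed X B g" "framed X B' g'" using assms by (auto simp: frames_def)
  then have l: "is_lift H3 q (ideal_tetra X) (k X) g" "is_lift H3 q (ideal_tetra X) (k X) g'"
    and c: "continuous_on (tetra X) g" "continuous_on (tetra X) g'"
        and im: "g \<in> tetra X \<rightarrow> cball 0 1"
    and d: "det B \<noteq> 0" "det B' \<noteq> 0"
    by (simp_all add: framed_def)
  obtain \<Phi> where \<Phi>: "deck \<Phi>" "\<And>s. s \<in> ideal_tetra X \<Longrightarrow> g' s = \<Phi> (g s)"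
    using deck_between[OF l convex_connected[OF convex_ideal_tetra] ideal_tetra_nonempty
        k_cont] by metis
  then have \<Phi>I: "\<Phi> \<in> Isom_plus" by (simp add: deck_def)
  obtain A :: "complex^2^2" where A: "det A \<noteq> 0" "\<And>a. a \<noteq> 0 \<Longrightarrow> \<Phi> (ideal_point a) =
      ideal_point (A *v a)"
    using Isom_plus_Moebius[OF \<Phi>I] by metis
  have \<Phi>g: "continuous_on (tetra X) (\<Phi> \<circ> g)"
    using c(1) im by (intro continuous_on_compose continuous_on_subset[OF
        Isom_plusD(1)[OF \<Phi>I]]) auto
  have v: "ideal_point ((A ** B) *v vertex_vec z X a) = ideal_point (B' *v vertex_vec z X a)"
      if a: "a \<in> set (verts X)" for a
  proof -
    obtain s where s: "\<And>n::nat. s n \<in> ideal_tetra X"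
      "\<And>g. continuous_on (tetra X) g \<Longrightarrow> (\<lambda>n. g (s n) :: real^3) \<longlonglongrightarrow> g (axis a 1)"
      using tetra_limit[OF a] by metis
    have "(\<lambda>n. g' (s n)) \<longlonglongrightarrow> \<Phi> (g (axis a 1))"
      using s(2)[OF \<Phi>g] by (simp add: \<Phi>(2)[OF s(1)])
    then have "\<Phi> (g (axis a 1)) = g' (axis a 1)"
      using s(2)[OF c(2)] LIMSEQ_unique by blast
    then show ?thesis
      using g a A(2) matrix_vector_nonzero[OF d(1)]
          by (simp add: framed_def matrix_vector_mul_assoc)
  qed
  have dAB: "det (A ** B) \<noteq> 0" using A d by (simp add: det_mul)
  have vs: "verts X ! 0 \<in> set (verts X)" "verts X ! 1 \<in> set (verts X)" "verts X ! 2 \<in> set (verts X)"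
    "verts X ! 0 \<noteq> verts X ! 1" "verts X ! 0 \<noteq> verts X ! 2" "verts X ! 1 \<noteq> verts X ! 2"
    by (cases X; simp)+
  have "ideal_point ((A ** B) *v a) = ideal_point (B' *v a)" if "a \<noteq> 0" for a
    by (rule ideal_point_matrix_eqI[OF dAB d(2) _ _ _ v[OF vs(1)] v[OF vs(2)] v[OF vs(3)] that])
       (intro cross2_vertex_vec z vs)+
  then show ?thesis
    using that[OF \<Phi>(1)] A(2) matrix_vector_nonzero[OF d(1)] by (simp add: matrix_vector_mul_assoc)
qed

text \<open>The deck transformation taking \<open>B\<close> to \<open>B'\<close> also takes
  \<open>B ** E\<close> to \<open>B' ** E\<close>. This makes the set of such \<open>E\<close>
  closed under products.\<close>

lemma frames_translate:
  assumes "B \<in> frames X" "B' \<in> frames X" "B ** E \<in> frames X"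
  shows "B' ** E \<in> frames X"
proof -
  obtain \<Phi> where \<Phi>: "deck \<Phi>" "\<And>a. a \<noteq> 0 \<Longrightarrow> \<Phi> (ideal_point (B *v a)) = ideal_point (B' *v a)"
    using frames_deck[OF assms(1,2)] by metis
  obtain g where g: "framed X (B ** E) g" using assms(3) by (auto simp: frames_def)
  obtain g' where g': "framed X B' g'" using assms(2) by (auto simp: frames_def)
  have d: "det E \<noteq> 0" "det (B' ** E) \<noteq> 0"
    using g g' by (auto simp: framed_def det_mul)
  have "framed X (B' ** E) (\<Phi> \<circ> g)"
    using \<Phi>(2)[OF matrix_vector_nonzero[OF d(1) vertex_vec_nonzero]]
    by (intro framed_deck[OF g \<Phi>(1) d(2)]) (simp add: matrix_vector_mul_assoc[symmetric])
  then show ?thesis by (auto simp: frames_def)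
qed

text \<open>One step of developing. Matching three vertices projectively suffices, since the modulus
  of \<open>Y\<close> then fixes the fourth.\<close>

lemma frames_cross_face:
  assumes pair: "((X, F), (Y, G)) \<in> face_pairings" and B: "B \<in> frames X" and B': "det B' \<noteq> 0"
    and match: "\<And>i. i < 3 \<Longrightarrow> cross2 (B' *v vertex_vec z Y (G ! i)) (B *v vertex_vec z X (F ! i)) = 0"
  shows "B' \<in> frames Y"
proof -
  have FG: "distinct F" "distinct G" "length F = 3" "length G = 3"
      "set F \<subseteq> set (verts X)" "set G \<subseteq> set (verts Y)"
    using pair unfolding face_pairings_def by auto
  define S where "S = ideal_tetra X \<inter> subsimplex (set F)"
  define \<sigma> where "\<sigma> = face_map F G"
  have \<sigma>: "\<sigma> s \<in> ideal_tetra Y \<inter> subsimplex (set G)" "map (($) s) F = map (($) (\<sigma> s)) G"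
      if "s \<in> S" for s
    using face_map_face[of F G Y s X] FG that by (auto simp: S_def \<sigma>_def)
  have k\<sigma>: "k X s = k Y (\<sigma> s)" if "s \<in> S" for s
    by (rule k_glued) (use \<sigma>[OF that] that pair in \<open>auto simp: glued_def S_def\<close>)
  obtain g where g: "framed X B g" using B by (auto simp: frames_def)
  have card: "2 \<le> card (set F)" using FG by (simp add: distinct_card)
  define s0 where "s0 = barycenter (set F)"
  have s0: "s0 \<in> S"
    using barycenter_in[OF card FG(5)] by (simp add: S_def s0_def)
  have gX: "is_lift H3 q (ideal_tetra X) (k X) g" "continuous_on (tetra X) g"
    using g by (auto simp: framed_def)
  have "g s0 \<in> H3" "q (g s0) = k X s0" using gX s0 by (auto simp: is_lift_def S_def)
  \<comment> \<open>The lift over \<open>Y\<close> starts at the value of \<open>g\<close> at the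
    barycenter of the common face, so it continues \<open>g\<close> across that face.\<close>
  then obtain h where h: "continuous_on (ideal_tetra Y) h" "h \<in> ideal_tetra Y \<rightarrow> H3"
      "h (\<sigma> s0) = g s0"
      "\<And>y. y \<in> ideal_tetra Y \<Longrightarrow> q (h y) = k Y y"
    using covering_space_lift_strong[OF covering, of "g s0" "\<sigma> s0" "ideal_tetra Y" "k Y"]
      \<sigma>[OF s0] convex_imp_simply_connected[OF convex_ideal_tetra]
      convex_imp_locally_path_connected[OF convex_ideal_tetra] k_cont k_in k\<sigma>[OF s0]
    by (metis IntD1)
  have "is_lift H3 q (ideal_tetra Y) (k Y) h" using h by (simp add: is_lift_def)
  from framed_lift[OF this] obtain B'' g'
    where g': "framed Y B'' g'" "\<And>s. s \<in> ideal_tetra Y \<Longrightarrow> g' s = h s" by metis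
  have gY: "is_lift H3 q (ideal_tetra Y) (k Y) g'" "continuous_on (tetra Y) g'"
    using g' by (auto simp: framed_def)
  have S: "S \<subseteq> ideal_tetra X" "\<sigma> ` S \<subseteq> ideal_tetra Y" using \<sigma> by (auto simp: S_def)
  have "is_lift H3 q S (k X) g"
    using gX(1) S(1) by (auto simp: is_lift_def intro: continuous_on_subset)
  moreover have "is_lift H3 q S (k X) (g' \<circ> \<sigma>)"
  proof -
    have "continuous_on S (g' \<circ> \<sigma>)"
      unfolding \<sigma>_def
          by (intro continuous_on_compose continuous_on_face_map continuous_on_subset[OF gY(2)])
        (use S ideal_tetra_subset[of Y] in \<open>auto simp: \<sigma>_def\<close>)
    then show ?thesis
      using gY(1) S(2) k\<sigma> by (auto simp: is_lift_def Pi_iff image_subset_iff)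
  qed
  moreover have "connected S"
    unfolding S_def by (intro convex_connected convex_Int convex_ideal_tetra convex_subsimplex)
  moreover have "g s0 = (g' \<circ> \<sigma>) s0" using h(3) g'(2) \<sigma>[OF s0] by simp
  ultimately have agree: "g s = (g' \<circ> \<sigma>) s" if "s \<in> S" for s
    using lift_unique[OF _ _ _ continuous_on_subset[OF k_cont S(1)] s0 _ that] by blast
  have eq: "ideal_point (B'' *v vertex_vec z Y (G ! i)) =
      ideal_point (B' *v vertex_vec z Y (G ! i))" if i: "i < 3" for i
  proof -
    have Fi: "F ! i \<in> set F" "G ! i \<in> set G" using FG i by auto
    obtain s where s: "\<And>n::nat. s n \<in> S" "s \<longlonglongrightarrow> axis (F ! i) 1"
      using vertex_sequence[OF card FG(5) Fi(1)] by (auto simp: S_def)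
    have sX: "s n \<in> tetra X" "\<sigma> (s n) \<in> tetra Y" for n
      using s(1)[of n] S ideal_tetra_subset by blast+
    have ax: "axis (F ! i) 1 \<in> tetra X" "axis (G ! i) 1 \<in> tetra Y"
      using Fi FG by (auto intro: axis_in_tetra)
    have "(\<lambda>n. \<sigma> (s n)) \<longlonglongrightarrow> \<sigma> (axis (F ! i) 1)"
      unfolding \<sigma>_def
          by (rule continuous_on_tendsto_compose[OF continuous_on_face_map[of UNIV] s(2)]) auto
    then have \<sigma>s: "(\<lambda>n. \<sigma> (s n)) \<longlonglongrightarrow> axis (G ! i) 1"
      using face_map_axis[of F G i] FG i by (simp add: \<sigma>_def)
    have "(\<lambda>n. g (s n)) \<longlonglongrightarrow> g (axis (F ! i) 1)"
      by (rule continuous_on_tendsto_compose[OF gX(2) s(2) ax(1)]) (simp add: sX)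
    moreover have "(\<lambda>n. g' (\<sigma> (s n))) \<longlonglongrightarrow> g' (axis (G ! i) 1)"
      by (rule continuous_on_tendsto_compose[OF gY(2) \<sigma>s ax(2)]) (simp add: sX)
    ultimately have "g (axis (F ! i) 1) = g' (axis (G ! i) 1)"
      using agree[OF s(1)] LIMSEQ_unique by fastforce
    then have "ideal_point (B'' *v vertex_vec z Y (G ! i)) =
        ideal_point (B *v vertex_vec z X (F ! i))"
      using g g'(1) subsetD[OF FG(5) Fi(1)] subsetD[OF FG(6) Fi(2)] by (simp add: framed_def)
    also have "\<dots> = ideal_point (B' *v vertex_vec z Y (G ! i))"
      using match[OF i] g B' matrix_vector_nonzero by (subst eq_commute, subst ideal_point_eq_iff)
          (auto simp: framed_def)
    finally show ?thesis .
  qed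
  have dB'': "det B'' \<noteq> 0" using g' by (simp add: framed_def)
  have GY: "G ! 0 \<in> set (verts Y)" "G ! 1 \<in> set (verts Y)" "G ! 2 \<in> set (verts Y)"
    "G ! 0 \<noteq> G ! 1" "G ! 0 \<noteq> G ! 2" "G ! 1 \<noteq> G ! 2"
    using FG by (auto simp: nth_eq_iff_index_eq subset_iff)
  have "ideal_point (B' *v a) = ideal_point (B'' *v a)" if "a \<noteq> 0" for a
    by (rule ideal_point_matrix_eqI[OF B' dB'' _ _ _ eq[symmetric, of 0] eq[symmetric, of 1]
        eq[symmetric, of 2] that])
       ((intro cross2_vertex_vec z GY)+, simp_all)
  then show ?thesis
    using g' by (intro frames_eqI[OF _ B', of B'']) (auto simp: frames_def)
qed

text \<open>The deck transformations between the frames tend to the identity on the sphere, so some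
  move the origin arbitrarily little. Near the origin \<open>q\<close> is injective, hence such a
  transformation fixes it and is the identity.\<close>

lemma frames_discrete:
  assumes B: "B \<in> frames X" and Bn: "\<And>n::nat. Bs n \<in> frames X" and lim: "Bs \<longlonglongrightarrow> B"
    and a: "\<And>n. \<exists>a. a \<noteq> 0 \<and> ideal_point (Bs n *v a) \<noteq> ideal_point (B *v a)"
  shows False
proof -
  have "\<exists>\<Phi>. deck \<Phi> \<and> (\<forall>a. a \<noteq> 0 \<longrightarrow> \<Phi> (ideal_point (B *v a)) = ideal_point (Bs n *v a))" for n
    using frames_deck[OF B Bn[of n]] by metis
  then obtain \<Phi> where \<Phi>: "\<And>n. deck (\<Phi> n)" "\<And>n a. a \<noteq> 0 \<Longrightarrow> \<Phi> n (ideal_point (B *v a)) =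
      ideal_point (Bs n *v a)"
    by metis
  have \<Phi>I: "\<Phi> n \<in> Isom_plus" for n using \<Phi>(1) by (simp add: deck_def)
  have dB: "det B \<noteq> 0" using B by (auto simp: frames_def framed_def)
  have lim\<Phi>: "(\<lambda>n. \<Phi> n u) \<longlonglongrightarrow> u" if u: "norm u = 1" for u
  proof -
    obtain b where b: "b \<noteq> 0" "ideal_point b = u" using ideal_point_surj[OF u] by metis
    obtain a where a: "B *v a = b"
      using dB by (metis invertible_det_nz invertible_def matrix_vector_mul_assoc
          matrix_vector_mul_lid)
    have a0: "a \<noteq> 0" using a b by auto
    have "(\<lambda>n. Bs n *v a) \<longlonglongrightarrow> B *v a"
      unfolding matrix_vector_mult_def
      by (intro vec_tendstoI)
          (auto intro!: tendsto_intros tendsto_vec_nth[OF tendsto_vec_nth[OF lim]])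
    then have "(\<lambda>n. ideal_point (Bs n *v a)) \<longlonglongrightarrow> ideal_point (B *v a)"
      by (rule tendsto_ideal_point) (use a b in simp)
    then show ?thesis
      using \<Phi>(2)[OF a0] a b by simp
  qed
  obtain r where r: "strict_mono (r::nat \<Rightarrow> nat)" "(\<lambda>n. \<Phi> (r n) 0) \<longlonglongrightarrow> 0"
    using Isom_tendsto_id_subseq[OF \<Phi>I lim\<Phi>] by metis
  have 0: "(0::real^3) \<in> H3" by simp
  have nz: "\<Phi> n 0 \<noteq> 0" for n
  proof
    assume e: "\<Phi> n 0 = 0"
    have id: "is_lift H3 q H3 q id"
      using covering by (auto simp: is_lift_def continuous_on_id')
    have qc: "continuous_on H3 q" using covering by (simp add: covering_space_def)
    have fix_: "\<Phi> n x = x" if "x \<in> H3" for x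
      using lift_unique[OF deck_lift[OF \<Phi>(1) id] id connected_ball qc 0 _ that] e by simp
    obtain a where a: "a \<noteq> 0" "ideal_point (Bs n *v a) \<noteq> ideal_point (B *v a)"
        using assms(4) by blast
    have u: "norm (ideal_point (B *v a)) = 1"
        by (rule norm_ideal_point[OF matrix_vector_nonzero[OF dB a(1)]])
    obtain y where y: "\<And>m. y m \<in> H3" "y \<longlonglongrightarrow> ideal_point (B *v a)" using radial_sequence[OF u] by blast
    have "(\<lambda>m. \<Phi> n (y m)) \<longlonglongrightarrow> \<Phi> n (ideal_point (B *v a))"
      by (rule tendsto_Isom[OF Isom_plusD(1)[OF \<Phi>I] y])
    then have "\<Phi> n (ideal_point (B *v a)) = ideal_point (B *v a)"
      using y LIMSEQ_unique by (simp add: fix_) blast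
    then show False using \<Phi>(2)[OF a(1)] a(2) by simp
  qed
  obtain T u p where T: "0 \<in> T" "openin (top_of_set H3) T" "homeomorphism T u q p"
    using covering_space_local_homeomorphism[OF covering 0] by metis
  have "open T" using T(2) by (simp add: openin_open_eq)
  then have "\<forall>\<^sub>F n in sequentially. \<Phi> (r n) 0 \<in> T"
    using topological_tendstoD[OF r(2)] T(1) by blast
  then obtain n where "\<Phi> (r n) 0 \<in> T" by (auto simp: eventually_sequentially)
  moreover have "q (\<Phi> (r n) 0) = q 0" using \<Phi>(1) by (simp add: deck_def)
  ultimately have "\<Phi> (r n) 0 = 0"
    using T by (metis homeomorphism_apply1)
  then show False using nz by blast
qed

end

section \<open>Shimizu's lemma\<close>

definition mat2 :: "complex \<Rightarrow> complex \<Rightarrow> complex \<Rightarrow> complex \<Rightarrow> complex^2^2"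
  where "mat2 a b c d = vector [vector [a, b], vector [c, d]]"

lemma mat2_nth [simp]:
  "mat2 a b c d $ 1 $ 1 = a" "mat2 a b c d $ 1 $ 2 = b" "mat2 a b c d $ 2 $ 1 = c"
      "mat2 a b c d $ 2 $ 2 = d"
  by (simp_all add: mat2_def)

lemma det_mat2: "det (mat2 a b c d) = a * d - b * c"
  by (simp add: det_complex2)

lemma mat2_mult: "mat2 a b c d ** mat2 a' b' c' d' =
    mat2 (a * a' + b * c') (a * b' + b * d') (c * a' + d * c') (c * b' + d * d')"
  by (simp add: vec_eq_iff forall_2 matrix_matrix_mult_def sum_2)

lemma cross2_mat2:
  "cross2 (mat2 a b c d *v vector [x, y]) (mat2 a' b' c' d' *v vector [x', y']) =
    (a * x + b * y) * (c' * x' + d' * y') - (c * x + d * y) * (a' * x' + b' * y')"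
  by (simp add: cross2_def matrix_vector_2)

lemma mat2_id: "mat2 1 0 0 1 = mat 1"
  by (simp add: vec_eq_iff forall_2 mat_def)

text \<open>\<open>shimizu_conj \<tau> a c\<close> is \<open>A T A\<^sup>-\<^sup>1\<close>, where \<open>T\<close> is the translation by \<open>\<tau>\<close>
    and \<open>A\<close> has determinant
  1 and first column \<open>(a, c)\<close>; \<open>shimizu_seq\<close> iterates \<open>A \<mapsto> A T A\<^sup>-\<^sup>1\<close> on first columns.\<close>

definition shimizu_conj :: "complex \<Rightarrow> complex \<Rightarrow> complex \<Rightarrow> complex^2^2"
  where "shimizu_conj \<tau> a c = mat2 (1 - \<tau> * a * c) (\<tau> * a\<^sup>2) (- (\<tau> * c\<^sup>2)) (1 + \<tau> * a * c)"

primrec shimizu_seq :: "complex \<Rightarrow> complex \<times> complex \<Rightarrow> nat \<Rightarrow> complex \<times> complex"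
  where "shimizu_seq \<tau> x 0 = x"
  | "shimizu_seq \<tau> x (Suc n) = (case shimizu_seq \<tau> x n of (a, c) \<Rightarrow> (1 - \<tau> * a * c, - (\<tau> * c\<^sup>2)))"

text \<open>Up to sign, the product of \<open>\<tau>\<close> with the lower left entry is squared at
  each step, so it tends to 0 when it starts inside the unit disc.\<close>

lemma shimizu_seq_tendsto:
  assumes \<tau>: "\<tau> \<noteq> 0" and c: "c \<noteq> 0" and small: "cmod (c * \<tau>) < 1"
  shows "\<And>n. snd (shimizu_seq \<tau> (a, c) n) \<noteq> 0"
    and "(\<lambda>n. snd (shimizu_seq \<tau> (a, c) n)) \<longlonglongrightarrow> 0"
    and "(\<lambda>n. fst (shimizu_seq \<tau> (a, c) n)) \<longlonglongrightarrow> 1"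
proof -
  define \<alpha> \<gamma> where "\<alpha> n = fst (shimizu_seq \<tau> (a, c) n)"
      and "\<gamma> n = snd (shimizu_seq \<tau> (a, c) n)" for n
  have rec: "\<alpha> (Suc n) = 1 - \<alpha> n * (\<tau> * \<gamma> n)" "\<gamma> (Suc n) = - (\<tau> * (\<gamma> n)\<^sup>2)" for n
    by (simp_all add: \<alpha>_def \<gamma>_def split: prod.splits)
  have start: "\<gamma> 0 = c" by (simp add: \<gamma>_def)
  show nz: "snd (shimizu_seq \<tau> (a, c) n) \<noteq> 0" for n
    unfolding \<gamma>_def[symmetric] by (induction n) (use c \<tau> in \<open>auto simp: start rec\<close>)
  define r where "r = cmod (c * \<tau>)"
  have r: "0 \<le> r" "r < 1" using small by (auto simp: r_def)
  define x where "x n = \<tau> * \<gamma> n" for n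
  have x_rec: "x (Suc n) = - (x n * x n)" for n
    by (simp add: x_def rec power2_eq_square)
  have r_power: "r ^ Suc n \<le> r" for n
    using mult_left_mono[OF power_le_one[of r n], of r] r by simp
  have x: "cmod (x n) \<le> r ^ Suc n" for n
  proof (induction n)
    case 0
    show ?case by (simp add: x_def start r_def mult.commute)
  next
    case (Suc n)
    have "cmod (x n) * cmod (x n) \<le> r ^ Suc n * r"
      using Suc order_trans[OF Suc r_power] r by (intro mult_mono) auto
    then show ?case by (simp add: x_rec norm_mult mult.commute)
  qed
  have r0: "(\<lambda>n. r ^ Suc n) \<longlonglongrightarrow> 0"
    by (intro LIMSEQ_Suc LIMSEQ_realpow_zero r)
  have x0: "x \<longlonglongrightarrow> 0"
    by (rule Lim_null_comparison[OF _ r0]) (simp add: x del: power_Suc)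
  have "(\<lambda>n. x n / \<tau>) \<longlonglongrightarrow> 0 / \<tau>"
    by (intro tendsto_intros x0 \<tau>)
  then show "(\<lambda>n. snd (shimizu_seq \<tau> (a, c) n)) \<longlonglongrightarrow> 0"
    using \<tau> by (simp add: x_def \<gamma>_def)
  \<comment> \<open>Chosen so that the bound \<open>K\<close> survives the recursion:
    \<open>1 + K * r \<le> K\<close>.\<close>
  define K where "K = max (cmod (\<alpha> 0)) (1 / (1 - r))"
  have K: "1 + K * r \<le> K" "0 \<le> K"
  proof -
    have "1 / (1 - r) \<le> K" by (simp add: K_def)
    then have "1 \<le> K * (1 - r)" using r by (simp add: divide_le_eq)
    then show "1 + K * r \<le> K" by (simp add: algebra_simps)
    show "0 \<le> K" by (simp add: K_def le_max_iff_disj)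
  qed
  have \<alpha>K: "cmod (\<alpha> n) \<le> K" for n
  proof (induction n)
    case 0
    show ?case by (simp add: K_def)
  next
    case (Suc n)
    have "cmod (x n) \<le> r"
      using x r_power by (rule order_trans)
    then have "cmod (\<alpha> n) * cmod (x n) \<le> K * r"
      using Suc K by (intro mult_mono) auto
    moreover have "cmod (\<alpha> (Suc n)) \<le> 1 + cmod (\<alpha> n) * cmod (x n)"
      using norm_triangle_ineq4[of 1 "\<alpha> n * x n"] by (simp add: rec x_def norm_mult)
    ultimately show ?case using K by linarith
  qed
  have "(\<lambda>n. \<alpha> n * x n) \<longlonglongrightarrow> 0"
  proof (rule Lim_null_comparison)
    show "\<forall>\<^sub>F n in sequentially. norm (\<alpha> n * x n) \<le> K * cmod (x n)"
      using \<alpha>K by (simp add: norm_mult mult_right_mono)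
    show "(\<lambda>n. K * cmod (x n)) \<longlonglongrightarrow> 0"
      using tendsto_mult_right_zero[OF tendsto_norm_zero[OF x0]] .
  qed
  then have "(\<lambda>n. 1 - \<alpha> n * x n) \<longlonglongrightarrow> 1 - 0"
    by (intro tendsto_intros)
  then have "(\<lambda>n. \<alpha> (Suc n)) \<longlonglongrightarrow> 1" by (simp add: rec x_def)
  then show "(\<lambda>n. fst (shimizu_seq \<tau> (a, c) n)) \<longlonglongrightarrow> 1"
    unfolding \<alpha>_def by (rule LIMSEQ_imp_Suc)
qed

lemma tendsto_matrix_mult:
  fixes A :: "complex^2^2"
  assumes "\<And>i j. ((\<lambda>n. E n $ i $ j) \<longlongrightarrow> E' $ i $ j) F"
  shows "((\<lambda>n. A ** E n) \<longlongrightarrow> A ** E') F"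
  unfolding matrix_matrix_mult_def
  by (intro vec_tendstoI) (auto intro!: tendsto_intros assms)

context development
begin

text \<open>Below the bound, the iterated conjugates of the translation converge to the translation
  without ever equalling it, against discreteness.\<close>

lemma frames_shimizu:
  assumes B: "B \<in> frames X" and T: "B ** mat2 1 \<tau> 0 1 \<in> frames X"
      and A: "B ** mat2 a b c d \<in> frames X"
    and det: "a * d - b * c = 1" and nz: "\<tau> \<noteq> 0" "c \<noteq> 0"
  shows "1 \<le> cmod (c * \<tau>)"
proof (rule ccontr)
  assume "\<not> 1 \<le> cmod (c * \<tau>)"
  then have small: "cmod (c * \<tau>) < 1" by simp
  define G where "G = {E. B ** E \<in> frames X}"
  have mult: "E1 ** E2 \<in> G" if "E1 \<in> G" "E2 \<in> G" for E1 E2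
    using frames_translate[OF B, of "B ** E1" E2] that by (simp add: G_def matrix_mul_assoc)
  have conj: "shimizu_conj \<tau> a c \<in> G" if E: "mat2 a b c d \<in> G"
      and det: "a * d - b * c = 1" for a b c d
  proof -
    have inv: "mat2 a b c d ** mat2 d (- b) (- c) a = mat 1"
      using det by (simp add: mat2_mult mat2_id[symmetric] algebra_simps)
    have "B ** mat2 a b c d ** mat2 d (- b) (- c) a \<in> frames X"
      using B by (simp add: matrix_mul_assoc[symmetric] inv)
    \<comment> \<open>Seen from the frame \<open>B ** mat2 a b c d\<close>, the frame
      \<open>B\<close> is reached by the inverse matrix; translating back to \<open>B\<close> puts
      this inverse into \<open>G\<close>.\<close>
    then have "mat2 d (- b) (- c) a \<in> G"
      using frames_translate[OF _ B, of "B ** mat2 a b c d"] E by (simp add: G_def)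
    moreover have "mat2 1 \<tau> 0 1 \<in> G" using T by (simp add: G_def)
    ultimately have "mat2 a b c d ** mat2 1 \<tau> 0 1 ** mat2 d (- b) (- c) a \<in> G"
      by (intro mult E)
    moreover have "mat2 a b c d ** mat2 1 \<tau> 0 1 ** mat2 d (- b) (- c) a = shimizu_conj \<tau> a c"
      using det by (simp add: mat2_mult shimizu_conj_def power2_eq_square algebra_simps)
    ultimately show ?thesis by simp
  qed
  define \<alpha> \<gamma> where "\<alpha> n = fst (shimizu_seq \<tau> (a, c) n)"
      and "\<gamma> n = snd (shimizu_seq \<tau> (a, c) n)" for n
  have rec: "\<alpha> (Suc n) = 1 - \<tau> * \<alpha> n * \<gamma> n" "\<gamma> (Suc n) = - (\<tau> * (\<gamma> n)\<^sup>2)" for n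
    by (simp_all add: \<alpha>_def \<gamma>_def split: prod.splits)
  have lims: "\<And>n. \<gamma> n \<noteq> 0" "\<gamma> \<longlonglongrightarrow> 0" "\<alpha> \<longlonglongrightarrow> 1"
    using shimizu_seq_tendsto[OF nz small] unfolding \<alpha>_def \<gamma>_def by auto
  \<comment> \<open>The conjugate built from the n-th pair has the pair with index
    \<open>Suc n\<close> as its first column, so \<open>conj\<close> applies again.\<close>
  have G: "shimizu_conj \<tau> (\<alpha> n) (\<gamma> n) \<in> G" for n
  proof (induction n)
    case 0
    show ?case using conj[of a b c d] A det by (simp add: G_def \<alpha>_def \<gamma>_def)
  next
    case (Suc n)
    show ?case
      unfolding rec by (rule conj[OF Suc[unfolded shimizu_conj_def]])
          (simp add: power2_eq_square algebra_simps)
  qed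
  have dB: "det B \<noteq> 0" using B by (auto simp: frames_def framed_def)
  show False
  proof (rule frames_discrete[OF T])
    show "B ** shimizu_conj \<tau> (\<alpha> n) (\<gamma> n) \<in> frames X" for n using G[of n] by (simp add: G_def)
    show "(\<lambda>n. B ** shimizu_conj \<tau> (\<alpha> n) (\<gamma> n)) \<longlonglongrightarrow> B ** mat2 1 \<tau> 0 1"
    proof (rule tendsto_matrix_mult)
      fix i j :: 2
      have "(\<lambda>n. 1 - \<tau> * \<alpha> n * \<gamma> n) \<longlonglongrightarrow> 1 - \<tau> * 1 * 0" "(\<lambda>n. \<tau> * (\<alpha> n)\<^sup>2) \<longlonglongrightarrow> \<tau> * 1\<^sup>2"
        "(\<lambda>n. - (\<tau> * (\<gamma> n)\<^sup>2)) \<longlonglongrightarrow> - (\<tau> * 0\<^sup>2)" "(\<lambda>n. 1 + \<tau> * \<alpha> n * \<gamma> n) \<longlonglongrightarrow> 1 + \<tau> * 1 * 0"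
        by (intro tendsto_intros lims)+
      then show "(\<lambda>n. shimizu_conj \<tau> (\<alpha> n) (\<gamma> n) $ i $ j) \<longlonglongrightarrow> mat2 1 \<tau> 0 1 $ i $ j"
        using exhaust_2[of i] exhaust_2[of j] by (elim disjE) (simp_all add: shimizu_conj_def)
    qed
    show "\<exists>a. a \<noteq> 0 \<and> ideal_point (B ** shimizu_conj \<tau> (\<alpha> n) (\<gamma> n) *v a) \<noteq> ideal_point
        (B ** mat2 1 \<tau> 0 1 *v a)" for n
    proof (intro exI conjI)
      \<comment> \<open>The point infinity: the translation fixes it, while the conjugate moves it
        because its lower left entry is nonzero.\<close>
      let ?e = "vector [1, 0] :: complex^2"
      let ?S = "shimizu_conj \<tau> (\<alpha> n) (\<gamma> n)"
      show e: "?e \<noteq> 0" by (simp add: vec2_eq_iff)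
      have "det ?S = 1" by (simp add: shimizu_conj_def det_mat2 power2_eq_square algebra_simps)
      then have "?S *v ?e \<noteq> 0" "mat2 1 \<tau> 0 1 *v ?e \<noteq> 0"
        using matrix_vector_nonzero[OF _ e] by (auto simp: det_mat2)
      moreover have "cross2 (?S *v ?e) (mat2 1 \<tau> 0 1 *v ?e) \<noteq> 0"
        using nz lims(1) by (simp add: cross2_def matrix_vector_2 shimizu_conj_def)
      ultimately show "ideal_point (B ** ?S *v ?e) \<noteq> ideal_point (B ** mat2 1 \<tau> 0 1 *v ?e)"
        using dB by (simp add: matrix_vector_mul_assoc[symmetric] ideal_point_eq_iff
            matrix_vector_nonzero cross2_matrix)
    qed
  qed
qed

text \<open>All frames are written relative to one \<open>B\<close>, whose determinant factors out
  of \<open>cross2\<close>; the conditions left involve only explicit matrices.\<close>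

lemma frames_step:
  assumes "B ** E \<in> frames X" "((X, [a, b, c]), (Y, [a', b', c'])) \<in> face_pairings"
      "det B \<noteq> 0" "det E' \<noteq> 0"
    "cross2 (E' *v vertex_vec z Y a') (E *v vertex_vec z X a) = 0"
    "cross2 (E' *v vertex_vec z Y b') (E *v vertex_vec z X b) = 0"
    "cross2 (E' *v vertex_vec z Y c') (E *v vertex_vec z X c) = 0"
  shows "B ** E' \<in> frames Y"
proof (rule frames_cross_face[OF assms(2,1)])
  show "det (B ** E') \<noteq> 0" using assms by (simp add: det_mul)
  fix i :: nat assume "i < 3"
  then have "i = 0 \<or> i = 1 \<or> i = 2" by auto
  then show "cross2 (B ** E' *v vertex_vec z Y ([a', b', c'] ! i)) (B ** E *v vertex_vec z X
      ([a, b, c] ! i)) = 0"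
    using assms(5-7) by (auto simp: matrix_vector_mul_assoc[symmetric] cross2_matrix)
qed

end

section \<open>The holonomy of solution 2\<close>

text \<open>In terms of \<open>v = w\<^sup>2 + w - 1\<close> one has \<open>w = 1 + v\<^sup>2\<close>, \<open>z\<^sub>A = 1 - 1 / v\<close> and
  \<open>z\<^sub>B = 1 / (1 - v)\<close>; below, quotients are written as polynomials in \<open>v\<close>, using \<open>1 / v = 1 - 3 v - v\<^sup>3\<close>.\<close>

lemma v_reduce:
  fixes v :: complex
  assumes "v ^ 4 + 3 * v\<^sup>2 - v + 1 = 0"
  shows "v * (v * (v * v)) = v - 3 * (v * v) - 1" "v * (v * (v * (v * x))) =
      v * x - 3 * (v * (v * x)) - x"
proof -
  show 1: "v * (v * (v * v)) = v - 3 * (v * v) - 1"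
    using assms by (simp add: power2_eq_square power4_eq_xxxx eq_diff_eq add_eq_0_iff2
        algebra_simps)
  have "v * (v * (v * (v * x))) = (v * (v * (v * v))) * x" by (simp add: algebra_simps)
  then show "v * (v * (v * (v * x))) = v * x - 3 * (v * (v * x)) - x"
    unfolding 1 by (simp add: algebra_simps)
qed

lemma P_poly_v:
  assumes "P_poly w = 0" and v: "v = w\<^sup>2 + w - 1"
  shows "w = 1 + v\<^sup>2" "v ^ 4 + 3 * v\<^sup>2 - v + 1 = 0" "v \<noteq> 0" "v \<noteq> 1"
    "solution w TA = 3 * v + v ^ 3" "solution w TB = (3 + 4 * v + v\<^sup>2 + v ^ 3) / 4"
    "solution w TC = 1 + v\<^sup>2" "solution w TD = 1 + v\<^sup>2"
proof -
  have P: "w^4 + 2 * w^3 - w\<^sup>2 - 3 * w + 2 = 0"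
    using assms by (simp add: P_poly_def)
  have "w^4 + 2 * w^3 - w\<^sup>2 - 3 * w + 2 = v\<^sup>2 - w + 1"
    unfolding v by (simp add: algebra_simps power2_eq_square power3_eq_cube power4_eq_xxxx)
  with P have "v\<^sup>2 - w + 1 = 0" by metis
  then show w: "w = 1 + v\<^sup>2" by (simp add: add_eq_0_iff2 algebra_simps)
  have "w\<^sup>2 = v - w + 1" using v by simp
  then have w2: "w\<^sup>2 = v - v\<^sup>2" using w by simp
  then have "(1 + v\<^sup>2)\<^sup>2 = v - v\<^sup>2" using w by metis
  moreover have "v ^ 4 + 3 * v\<^sup>2 - v + 1 = (1 + v\<^sup>2)\<^sup>2 - (v - v\<^sup>2)"
    by (simp add: power2_eq_square power4_eq_xxxx algebra_simps)
  ultimately show R: "v ^ 4 + 3 * v\<^sup>2 - v + 1 = 0" by simp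
  show v0: "v \<noteq> 0" "v \<noteq> 1" using R by auto
  have "v - v\<^sup>2 = v * (1 - v)" by (simp add: power2_eq_square algebra_simps)
  then have nz: "v - v\<^sup>2 \<noteq> 0" "- v\<^sup>2 \<noteq> 0" using v0 by auto
  have "solution w TA = (v - v\<^sup>2) / (- v\<^sup>2)" using w w2 by simp
  also have "\<dots> = 3 * v + v ^ 3"
    unfolding nonzero_divide_eq_eq[OF nz(2)]
    by (simp add: algebra_simps power2_eq_square power3_eq_cube v_reduce[OF R])
  finally show "solution w TA = 3 * v + v ^ 3" .
  have "solution w TB = v / (v - v\<^sup>2)" using v w2 by simp
  \<comment> \<open>The denominator 4 is the value of the quartic at 1; dividing the quartic by
    \<open>v - 1\<close> gives the cubic.\<close>
  also have "\<dots> = (3 + 4 * v + v\<^sup>2 + v ^ 3) / 4"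
    unfolding nonzero_divide_eq_eq[OF nz(1)]
    by (simp add: algebra_simps power2_eq_square power3_eq_cube v_reduce[OF R])
  finally show "solution w TB = (3 + 4 * v + v\<^sup>2 + v ^ 3) / 4" .
  show "solution w TC = 1 + v\<^sup>2" "solution w TD = 1 + v\<^sup>2" using w by simp_all
qed

text \<open>Each matrix is the solution, up to a convenient scalar, of the three vertex conditions
  at one face. \<open>big\<close> says exactly that the product in Shimizu's lemma has modulus below
  1.\<close>

lemma (in development) no_development:
  assumes R: "v ^ 4 + 3 * v\<^sup>2 - v + 1 = 0" and big: "cmod (1 - v) < cmod v ^ 3"
    and zv: "z TA = 3 * v + v ^ 3" "z TB = (3 + 4 * v + v\<^sup>2 + v ^ 3) / 4" "z TC = 1 + v\<^sup>2"
        "z TD = 1 + v\<^sup>2"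
  shows False
proof -
  have v: "v \<noteq> 0" "v \<noteq> 1" "1 \<noteq> v" "1 + v\<^sup>2 \<noteq> 0"
    using R z[of TC] zv by auto
  obtain B where B: "B \<in> frames TD" by (rule frames_nonempty)
  then have dB: "det B \<noteq> 0" by (auto simp: frames_def framed_def)
  have B1: "B ** mat2 1 0 0 1 \<in> frames TD" using B by (simp add: mat2_id)
  \<comment> \<open>Unfolds powers into nested products and reduces them by the quartic, so every
    vertex condition becomes an identity of polynomials of degree at most 3.\<close>
  note poly = algebra_simps power2_eq_square power3_eq_cube v_reduce[OF R]
  have "B ** mat2 (1 + v\<^sup>2) 0 (1 - v) (v - 1) \<in> frames TA"
    by (rule frames_step[OF B1, of V0 V11 V43 _ V0 V01 V10],
        simp add: face_pairings_def, simp add: dB)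
      (use v in \<open>simp add: det_mat2\<close>, simp_all add: zv cross2_mat2 poly)
  then have "B ** mat2 (1 + v\<^sup>2) (- (1 + v\<^sup>2)) 0 v \<in> frames TB"
    by (rule frames_step[of _ _ _ V0 V01 V11 _ V10 V11 V21],
        simp add: face_pairings_def, simp add: dB)
      (use v in \<open>simp add: det_mat2\<close>, simp_all add: zv cross2_mat2 poly)
  then have "B ** mat2 (1 + v\<^sup>2) (- (1 + v\<^sup>2) * (1 - v)) 0 (v * (1 - v)) \<in> frames TC"
    by (rule frames_step[of _ _ _ V0 V11 V21 _ V0 V11 V21],
        simp add: face_pairings_def, simp add: dB)
      (use v in \<open>simp add: det_mat2\<close>, simp_all add: zv cross2_mat2 poly)
  \<comment> \<open>Along this loop the vertex 1/1 of \<open>D\<close> corresponds to 0/1 in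
    \<open>A\<close> and to 1/1 in \<open>B\<close> and \<open>C\<close>. It stays at infinity, so
    the holonomy is a translation.\<close>
  then have T: "B ** mat2 1 (- 1 + 2 * v + v ^ 3) 0 1 \<in> frames TD"
    by (rule frames_step[of _ _ _ V0 V11 V32 _ V0 V11 V32],
        simp add: face_pairings_def, simp add: dB)
      (use v in \<open>simp add: det_mat2\<close>, simp_all add: zv cross2_mat2 poly)
  have "2 * v\<^sup>2 - v + 1 = - (v\<^sup>2 * (1 + v\<^sup>2))"
    by (simp add: poly)
  then have "2 * v\<^sup>2 - v + 1 \<noteq> 0"
    using v by (simp del: minus_mult_right minus_mult_left)
  moreover have "det (mat2 (1 + v\<^sup>2) (- (1 + v\<^sup>2)) 1 (- 1 - v)) = - v * (1 + v\<^sup>2)"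
      "det (mat2 (v\<^sup>2 - v) (- (v\<^sup>2)) (- (1 + v\<^sup>2)) (1 - v + v\<^sup>2)) = - v * (2 * v\<^sup>2 - v + 1)"
    by (simp_all add: det_mat2 poly)
  ultimately have det: "det (mat2 (1 + v\<^sup>2) (- (1 + v\<^sup>2)) 1 (- 1 - v)) \<noteq> 0"
      "det (mat2 (v\<^sup>2 - v) (- (v\<^sup>2)) (- (1 + v\<^sup>2)) (1 - v + v\<^sup>2)) \<noteq> 0"
    using v by simp_all
  \<comment> \<open>The second loop turns around 3/2, placed at 1: it corresponds to 1/0 in
    \<open>A\<close> and \<open>B\<close>, to 2/1 in \<open>C\<close> and again to 3/2 in
    \<open>D\<close>.\<close>
  have "B ** mat2 (1 + v\<^sup>2) (- (1 + v\<^sup>2)) 1 (- 1 - v) \<in> frames TA"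
    by (rule frames_step[OF B1, of V0 V32 V43 _ V01 V10 V11],
        simp add: face_pairings_def, simp add: dB)
      (rule det(1), simp_all add: zv cross2_mat2 poly)
  then have "B ** mat2 (v\<^sup>2 - v) (- (v\<^sup>2)) (- (1 + v\<^sup>2)) (1 - v + v\<^sup>2) \<in> frames TB"
    by (rule frames_step[of _ _ _ V0 V10 V11 _ V0 V10 V11],
        simp add: face_pairings_def, simp add: dB)
      (rule det(2), simp_all add: zv cross2_mat2 poly)
  then have "B ** mat2 1 (- 2) (2 + v\<^sup>2) (- 3 - v\<^sup>2) \<in> frames TC"
    by (rule frames_step[of _ _ _ V0 V10 V21 _ V11 V21 V32],
        simp add: face_pairings_def, simp add: dB)
      (use v in \<open>simp add: det_mat2 poly\<close>, simp_all add: zv cross2_mat2 poly)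
  \<comment> \<open>With \<open>c\<close> for the lower left entry, the rows are
    \<open>(1 + c, - c)\<close> and \<open>(c, 1 - c)\<close>: a parabolic matrix of determinant 1
    fixing the point 1.\<close>
  then have A: "B ** mat2 (- 3 + 2 * v - v\<^sup>2 + v ^ 3) (4 - 2 * v + v\<^sup>2 - v ^ 3)
      (- 4 + 2 * v - v\<^sup>2 + v ^ 3) (5 - 2 * v + v\<^sup>2 - v ^ 3) \<in> frames TD"
    by (rule frames_step[of _ _ _ V0 V21 V32 _ V11 V32 V43],
        simp add: face_pairings_def, simp add: dB)
      (use v in \<open>simp add: det_mat2 poly\<close>, simp_all add: zv cross2_mat2 poly)
  define c \<tau> where "c = - 4 + 2 * v - v\<^sup>2 + v ^ 3" and "\<tau> = - 1 + 2 * v + v ^ 3"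
  have c\<tau>: "c * \<tau> * v ^ 3 = v - 1"
    unfolding c_def \<tau>_def by (simp add: poly)
  then have nz: "c \<noteq> 0" "\<tau> \<noteq> 0" using v by auto
  have "1 \<le> cmod (c * \<tau>)"
    using frames_shimizu[OF B T[folded \<tau>_def] A[folded c_def] _ nz(2,1)]
    by (simp add: c_def poly)
  then have "cmod v ^ 3 \<le> cmod (c * \<tau>) * cmod v ^ 3"
    by (simp add: mult_le_cancel_right1)
  also have "\<dots> = cmod (1 - v)"
    unfolding norm_power[symmetric] norm_mult[symmetric] c\<tau> by (rule norm_minus_commute)
  finally show False using big by simp
qed

lemma solution2_bound:
  fixes w :: complex
  assumes "\<bar>Re w - (- 1.7271548)\<bar> < 1 / 10^6" "\<bar>Im w - (- 0.6779619)\<bar> < 1 / 10^6"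
    and v: "v = w\<^sup>2 + w - 1"
  shows "cmod (1 - v) < cmod v ^ 3"
proof -
  \<comment> \<open>The signs make both quantities positive, so products can be bounded
    monotonically.\<close>
  define x y where "x = - Re w" and "y = - Im w"
  have x: "1.7271 \<le> x" "x \<le> 1.7272" and y: "0.6779 \<le> y" "y \<le> 0.678"
    using assms(1,2) by (auto simp: x_def y_def abs_if split: if_splits)
  have Re: "Re v = x\<^sup>2 - y\<^sup>2 - x - 1" and Im: "Im v = y * (2 * x - 1)"
    by (simp_all add: v x_def y_def power2_eq_square algebra_simps)
  have "1.7271\<^sup>2 \<le> x\<^sup>2" "x\<^sup>2 \<le> 1.7272\<^sup>2" "0.6779\<^sup>2 \<le> y\<^sup>2" "y\<^sup>2 \<le> 0.678\<^sup>2"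
    using x y by (auto intro!: power_mono)
  then have re: "- 0.21 \<le> Re v" "Re v \<le> 0"
    unfolding Re using x y by (auto simp: power2_eq_square)
  have "0.6779 * 2.454 \<le> Im v" "Im v \<le> 0.678 * 2.4545"
    unfolding Im by (rule mult_mono; use x y in simp)+
  then have im: "1.66 \<le> Im v" "Im v \<le> 1.67" by auto
  \<comment> \<open>The estimate has room to spare: the sum of absolute values is at most 2.88,
    while \<open>1.66 ^ 3\<close> exceeds 4.5.\<close>
  have "cmod (1 - v) \<le> \<bar>Re (1 - v)\<bar> + \<bar>Im (1 - v)\<bar>" by (rule cmod_le)
  also have "\<dots> \<le> 1.21 + 1.67" using re im by auto
  also have "\<dots> < 1.66 ^ 3" by (simp add: power3_eq_cube)
  also have "\<dots> \<le> cmod v ^ 3"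
    using im abs_Im_le_cmod[of v] by (intro power_mono) auto
  finally show ?thesis .
qed

theorem proposition5p1:
  fixes M :: "'m::real_normed_vector set"
    and \<phi> :: "tet \<Rightarrow> real^vlabel \<Rightarrow> 'm"
    and U :: "'u::real_normed_vector set"
    and p :: "'u \<Rightarrow> 'm"
    and w2 :: complex
  assumes "top_of_set M homeomorphic_space LR3"
    and "ideal_triangulation M \<phi>"
    and "universal_cover U p M"
    and "P_poly w2 = 0"
    and "\<bar>Re w2 - (- 1.7271548)\<bar> < 1 / 10^6"
    and "\<bar>Im w2 - (- 0.6779619)\<bar> < 1 / 10^6"
  shows "\<not> geometric M \<phi> U p (solution w2)"
proof
  assume "geometric M \<phi> U p (solution w2)"
  then obtain q f dev where q: "complete_hyperbolic_structure M q"
    and f: "continuous_on M f" "f \<in> M \<rightarrow> M"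
    and dev: "is_lift H3 q U (f \<circ> p) dev" "developing_map \<phi> U p (solution w2) dev"
    unfolding geometric_def hyperbolic_map_def by blast
  have quot: "continuous_map (sum_topology (\<lambda>X. top_of_set (ideal_tetra X)) UNIV) (top_of_set M)
      (\<lambda>a. \<phi> (fst a) (snd a))"
    and glue: "\<And>X Y s t. s \<in> ideal_tetra X \<Longrightarrow> t \<in> ideal_tetra Y \<Longrightarrow> equivclp glued (X, s) (Y, t) \<Longrightarrow>
        \<phi> X s = \<phi> Y t"
    using assms(2) unfolding ideal_triangulation_def by (auto intro: quotient_imp_continuous_map)
  have "continuous_map (top_of_set (ideal_tetra X)) (top_of_set M) (\<phi> X)" for X
    using continuous_map_compose[OF continuous_map_component_injection[of X UNIV "\<lambda>X. top_of_set
        (ideal_tetra X)"] quot]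
    by (simp add: o_def)
  then have \<phi>: "continuous_on (ideal_tetra X) (\<phi> X)" "\<phi> X \<in> ideal_tetra X \<rightarrow> M" for X
    by auto
  \<comment> \<open>The universal cover drops out here: composing \<open>dev\<close> with a lift of
    \<open>\<phi> X\<close> to \<open>U\<close> gives a lift of \<open>f \<circ> \<phi> X\<close>
    through \<open>q\<close>.\<close>
  interpret development M q "\<lambda>X. f \<circ> \<phi> X" "solution w2"
  proof
    show "complete_hyperbolic_structure M q" by (rule q)
    fix X Y s t
    show "continuous_on (ideal_tetra X) (f \<circ> \<phi> X)"
      using \<phi>[of X] by (intro continuous_on_compose continuous_on_subset[OF f(1)]) auto
    show "f \<circ> \<phi> X \<in> ideal_tetra X \<rightarrow> M"
      using \<phi>(2)[of X] f(2) by auto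
    show "(f \<circ> \<phi> X) s = (f \<circ> \<phi> Y) t" if "glued (X, s) (Y, t)"
    proof -
      have "s \<in> ideal_tetra X" "t \<in> ideal_tetra Y" using that by (auto simp: glued_def)
      then show ?thesis using glue[OF _ _ r_into_equivclp[of glued, OF that]] by simp
    qed
    show "solution w2 X \<noteq> 0" "solution w2 X \<noteq> 1"
      using hyperbolicity_equations_solution[OF assms(4)]
          by (simp_all add: hyperbolicity_equations_def)
    have "\<exists>\<psi>. is_lift U p (ideal_tetra X) (\<phi> X) \<psi> \<and>
        (\<exists>g. compatible_map X (solution w2 X) g \<and> (\<forall>s\<in>ideal_tetra X. g s = dev (\<psi> s)))"
      using dev(2) unfolding developing_map_def by (elim conjE allE[of _ X])
    then obtain \<psi> g where \<psi>: "is_lift U p (ideal_tetra X) (\<phi> X) \<psi>"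
        and g: "compatible_map X (solution w2 X) g"
      "\<And>s. s \<in> ideal_tetra X \<Longrightarrow> g s = dev (\<psi> s)"
      by blast
    have "continuous_on (ideal_tetra X) g"
      using g(1) ideal_tetra_subset[of X]
          by (auto simp: compatible_map_def Let_def intro: continuous_on_subset)
    then have "is_lift H3 q (ideal_tetra X) (f \<circ> \<phi> X) g"
      using \<psi> dev(1) by (auto simp: is_lift_def g(2) Pi_iff)
    with g(1) show "\<exists>g. compatible_map X (solution w2 X) g \<and>
        is_lift H3 q (ideal_tetra X) (f \<circ> \<phi> X) g" by blast
  qed
  show False
    using no_development[OF P_poly_v(2)[OF assms(4) refl] solution2_bound[OF assms(5,6) refl]
        P_poly_v(5-8)[OF assms(4) refl]] .
qed

end
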